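(* Let $p\in(1,\infty)$, $p'=\frac p{p-1}$, and $1<q\le r<\infty$. Then the Laplace transform $L:L^{p,q}(0,\infty)\to L^{p',r}(0,\infty)$ is maximally non-compact, i.e. $\alpha(L)=\|L\|$.
   Context: Laplace transform: $Lf(t)=\int_0^\infty f(s)e^{-ts}\,ds$, $t\in(0,\infty)$; it is bounded $L^{p,q}(0,\infty)\to L^{p',q}(0,\infty)\hookrightarrow L^{p',r}(0,\infty)$. Lorentz space $L^{p,q}(0,\infty)$: measurable $f$ with $\|f\|_{p,q}=\big(\int_0^\infty(t^{1/p}f^*(t))^q\frac{dt}t\big)^{1/q}<\infty$, $f^*$ the nonincreasing rearrangement. For a bounded linear $T:X\to Y$, the ball measure of non-compactness $\alpha(T)$ is the infimum of all $\rho>0$ such that $T(B_X)$ (image of the closed unit ball) can be covered by finitely many balls of radius $\rho$ in $Y$; $T$ is maximally non-compact if $\alpha(T)=\|T\|$. *)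

theory Defs
  imports "HOL-Analysis.Analysis"
begin

text \<open>Functions on (0,\<infinity>) are represented as functions real \<Rightarrow> real; only their
  values on {0<..} matter. The measure is Lebesgue measure.\<close>

definition distrib_fun :: "(real \<Rightarrow> real) \<Rightarrow> real \<Rightarrow> ennreal" where
  "distrib_fun f s = emeasure lebesgue {x \<in> {0<..}. s < \<bar>f x\<bar>}"

text \<open>Nonincreasing rearrangement f^*(t) = inf {s \<ge> 0. d_f(s) \<le> t} (value \<infinity> if empty).\<close>
definition rearr :: "(real \<Rightarrow> real) \<Rightarrow> real \<Rightarrow> ennreal" where
  "rearr f t = (INF s \<in> {s::real. 0 \<le> s \<and> distrib_fun f s \<le> ennreal t}. ennreal s)"

definition lorentz_integral :: "real \<Rightarrow> real \<Rightarrow> (real \<Rightarrow> real) \<Rightarrow> ennreal" where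
  "lorentz_integral p q f =
     (\<integral>\<^sup>+ t \<in> {0<..}. (if rearr f t = \<infinity> then \<infinity>
        else ennreal ((t powr (1/p) * enn2real (rearr f t)) powr q / t)) \<partial>lborel)"

definition lorentz_norm :: "real \<Rightarrow> real \<Rightarrow> (real \<Rightarrow> real) \<Rightarrow> real" where
  "lorentz_norm p q f = enn2real (lorentz_integral p q f) powr (1/q)"

definition lorentz_space :: "real \<Rightarrow> real \<Rightarrow> (real \<Rightarrow> real) set" where
  "lorentz_space p q = {f. f \<in> borel_measurable (lebesgue_on {0<..}) \<and> lorentz_integral p q f < \<infinity>}"

definition laplace :: "(real \<Rightarrow> real) \<Rightarrow> real \<Rightarrow> real" where
  "laplace f t = (LINT s:{0<..}|lebesgue. f s * exp (- (t * s)))"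

definition laplace_norm :: "real \<Rightarrow> real \<Rightarrow> real \<Rightarrow> real \<Rightarrow> real" where
  "laplace_norm p q p1 r =
     Sup {lorentz_norm p1 r (laplace f) | f. f \<in> lorentz_space p q \<and> lorentz_norm p q f \<le> 1}"

definition laplace_alpha :: "real \<Rightarrow> real \<Rightarrow> real \<Rightarrow> real \<Rightarrow> real" where
  "laplace_alpha p q p1 r =
     Inf {\<rho>. \<rho> > 0 \<and> (\<exists>F. finite F \<and> F \<subseteq> lorentz_space p1 r \<and>
        (\<forall>f. f \<in> lorentz_space p q \<and> lorentz_norm p q f \<le> 1 \<longrightarrow>
           (\<exists>g\<in>F. lorentz_norm p1 r (\<lambda>t. laplace f t - g t) \<le> \<rho>)))}"

end

theory Submission
  imports Defs
begin

text \<open>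
  The Laplace transform intertwines the isometric dilations of \<open>L(p,q)\<close> with those of \<open>L(p',r)\<close>.
  Given a finite net of radius \<open>\<rho>\<close> for the image of the unit ball and \<open>f\<close> in the ball, apply the
  net to a dilate of \<open>f\<close> and dilate back: then \<open>L f\<close> is within \<open>\<rho>\<close> of a dilate of a net element \<open>g\<close>.
  As \<open>t powr (1 / p') * rearr g t\<close> tends to 0 for \<open>t \<rightarrow> 0\<close>, strong dilates of \<open>g\<close> tend to 0 in measure,
  and the lower semicontinuity of the Lorentz norm gives \<open>\<parallel>L f\<parallel> \<le> \<rho>\<close>.
  Boundedness of \<open>L\<close> follows from \<open>\<bar>L f t\<bar> \<le> \<integral>\<^sub>0\<^sup>1\<^sup>/\<^sup>t rearr f\<close>, Hardy's inequality, and the embedding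
  of \<open>L(p',q)\<close> into \<open>L(p',r)\<close>.
\<close>

subsection \<open>Powers in the extended nonnegative reals\<close>

text \<open>Infinity is a fixed point for every exponent, as in the case split of
  \<open>lorentz_integral\<close>, and 0 goes to 0 as under \<open>powr\<close>. Hence the exponent
  laws below hold for all real exponents.\<close>

definition epow :: "ennreal \<Rightarrow> real \<Rightarrow> ennreal" where
  "epow x q = (if x = \<infinity> then \<infinity> else ennreal (enn2real x powr q))"

lemma epow_top [simp]: "epow top q = top"
  by (simp add: epow_def)

lemma epow_0 [simp]: "epow 0 q = 0"
  by (simp add: epow_def)

lemma epow_ennreal: "0 \<le> x \<Longrightarrow> epow (ennreal x) q = ennreal (x powr q)"
  by (simp add: epow_def)

lemma epow_mono: "0 < q \<Longrightarrow> x \<le> y \<Longrightarrow> epow x q \<le> epow y q"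
  by (cases x; cases y) (auto simp: epow_def top_unique intro!: ennreal_leI powr_mono2)

lemma epow_epow: "epow (epow x a) b = epow x (a * b)"
  by (cases x) (auto simp: epow_ennreal powr_powr)

lemma epow_1 [simp]: "epow x 1 = x"
  by (cases x) (auto simp: epow_ennreal)

lemma epow_cmult: "0 < c \<Longrightarrow> epow (ennreal c * x) q = ennreal (c powr q) * epow x q"
  by (cases x) (auto simp: epow_ennreal powr_mult ennreal_mult_top simp flip: ennreal_mult)

lemma epow_add: "epow x (a + b) = epow x a * epow x b"
  by (cases x) (auto simp: epow_ennreal powr_add ennreal_mult ennreal_top_mult)

lemma epow_measurable [measurable]: "(\<lambda>x. epow x q) \<in> borel_measurable borel"
  unfolding epow_def by measurable

text \<open>A sum is at most twice the maximum. The crude constant suffices because only finiteness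
  is drawn from it.\<close>

lemma epow_plus_le:
  assumes "0 < q"
  shows "epow (x + y) q \<le> ennreal (2 powr q) * (epow x q + epow y q)"
proof -
  have "x + y \<le> ennreal 2 * max x y"
    by (metis (no_types, lifting) add_mono ennreal_numeral max.cobounded1 max.cobounded2 mult_2)
  then have "epow (x + y) q \<le> ennreal (2 powr q) * epow (max x y) q"
    using epow_mono[OF assms] by (metis epow_cmult zero_less_numeral)
  also have "\<dots> \<le> ennreal (2 powr q) * (epow x q + epow y q)"
    by (intro mult_left_mono) (auto simp: max_def)
  finally show ?thesis .
qed

text \<open>For positive \<open>q\<close> the power is an order isomorphism with inverse exponent
  \<open>1 / q\<close>, so it commutes with suprema.\<close>

lemma epow_SUP:
  assumes "0 < q"
  shows "epow (SUP i. f i) q = (SUP i. epow (f i) q)"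
proof (rule antisym)
  have "(SUP i. f i) \<le> epow (SUP i. epow (f i) q) (1 / q)"
  proof (rule SUP_least)
    fix i
    have "f i = epow (epow (f i) q) (1 / q)"
      using assms by (simp add: epow_epow)
    also have "\<dots> \<le> epow (SUP i. epow (f i) q) (1 / q)"
      using assms by (intro epow_mono SUP_upper) auto
    finally show "f i \<le> \<dots>" .
  qed
  then show "epow (SUP i. f i) q \<le> (SUP i. epow (f i) q)"
    using epow_mono[OF assms] assms by (metis (no_types, lifting) epow_epow epow_1 less_irrefl nonzero_divide_eq_eq)
  show "(SUP i. epow (f i) q) \<le> epow (SUP i. f i) q"
    using assms by (intro SUP_least epow_mono SUP_upper) auto
qed

section \<open>Measurability of monotone functions and integrals of powers\<close>

lemma down_closed_borel:
  fixes A :: "real set"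
  assumes "\<And>x y. y \<in> A \<Longrightarrow> x \<le> y \<Longrightarrow> x \<in> A"
  shows "A \<in> sets borel"
proof (cases "A = {} \<or> A = UNIV")
  case False
  then obtain z where "z \<notin> A" "A \<noteq> {}" by auto
  then have bdd: "bdd_above A"
    using assms by (meson bdd_aboveI linear)
  have "A = {..<Sup A} \<or> A = {..Sup A}"
  proof (cases "Sup A \<in> A")
    case True
    then have "A = {..Sup A}" using assms bdd by (auto intro: cSup_upper)
    then show ?thesis by simp
  next
    case False
    have "A = {..<Sup A}"
    proof (intro set_eqI iffI)
      fix x assume "x \<in> A"
      then show "x \<in> {..<Sup A}" using False cSup_upper[OF _ bdd] by (metis lessThan_iff order_less_le)
    next
      fix x assume "x \<in> {..<Sup A}"
      then show "x \<in> A" using less_cSupE[OF _ \<open>A \<noteq> {}\<close>, of x] assms by (metis lessThan_iff less_imp_le)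
    qed
    then show ?thesis by simp
  qed
  then show ?thesis by (metis atMost_borel lessThan_borel)
qed auto

lemma antimono_measurable:
  fixes \<phi> :: "real \<Rightarrow> ennreal"
  assumes "antimono \<phi>"
  shows "\<phi> \<in> borel_measurable borel"
proof (rule borel_measurableI_greater)
  fix y
  show "{x \<in> space borel. y < \<phi> x} \<in> sets borel"
    using assms by (intro down_closed_borel) (auto simp: antimono_def intro: less_le_trans)
qed

lemma nn_integral_powr:
  assumes "0 < a" "0 \<le> x"
  shows "(\<integral>\<^sup>+t\<in>{0<..<x}. ennreal (t powr (a - 1)) \<partial>lborel) = ennreal (x powr a / a)"
proof -
  have "((\<lambda>t. t powr (a - 1)) has_integral (x powr a / a)) {0..x}"
    using has_integral_powr_from_0[of "a - 1" x] assms by simp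
  from nn_integral_has_integral_lebesgue'[OF _ this]
  have "(\<integral>\<^sup>+t\<in>{0..x}. ennreal (t powr (a - 1)) \<partial>lborel) = ennreal (x powr a / a)" by simp
  moreover have "(\<integral>\<^sup>+t\<in>{0..x}. ennreal (t powr (a - 1)) \<partial>lborel) = (\<integral>\<^sup>+t\<in>{0<..<x}. ennreal (t powr (a - 1)) \<partial>lborel)"
    by (rule nn_integral_cong_AE, rule AE_mp[OF AE_conjI[OF AE_lborel_singleton[of 0] AE_lborel_singleton[of x]]])
       (auto split: split_indicator)
  ultimately show ?thesis by simp
qed

subsection \<open>Weighted integrals of nonincreasing functions\<close>

text \<open>The q-th power of the Lorentz functional, with the weight and \<open>dt / t\<close>
  merged into one power of \<open>t\<close>. It takes an arbitrary function, so that it also applies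
  to Hardy averages and to shifted rearrangements.\<close>

definition lint :: "real \<Rightarrow> real \<Rightarrow> (real \<Rightarrow> ennreal) \<Rightarrow> ennreal" where
  "lint p q \<phi> = (\<integral>\<^sup>+t\<in>{0<..}. epow (\<phi> t) q * ennreal (t powr (q / p - 1)) \<partial>lborel)"

lemma lint_mono:
  assumes "0 < q" "\<And>t. 0 < t \<Longrightarrow> \<phi> t \<le> \<psi> t"
  shows "lint p q \<phi> \<le> lint p q \<psi>"
  unfolding lint_def using assms
  by (intro nn_integral_mono) (auto split: split_indicator intro!: mult_right_mono epow_mono)

lemma lint_cong: "(\<And>t. 0 < t \<Longrightarrow> \<phi> t = \<psi> t) \<Longrightarrow> lint p q \<phi> = lint p q \<psi>"
  unfolding lint_def by (intro nn_integral_cong) (auto split: split_indicator)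

lemma lorentz_integral_eq:
  assumes "0 < p" "0 < q"
  shows "lorentz_integral p q f = lint p q (rearr f)"
  unfolding lorentz_integral_def lint_def
proof (rule nn_integral_cong)
  fix t :: real
  have "(t powr (1/p) * enn2real (rearr f t)) powr q / t = enn2real (rearr f t) powr q * t powr (q / p - 1)"
    if "0 < t" using that assms by (simp add: powr_mult powr_powr powr_diff)
  then show "(if rearr f t = \<infinity> then \<infinity> else ennreal ((t powr (1/p) * enn2real (rearr f t)) powr q / t)) * indicator {0<..} t
     = epow (rearr f t) q * ennreal (t powr (q / p - 1)) * indicator {0<..} t"
    by (auto simp: epow_def ennreal_mult ennreal_top_mult split: split_indicator)
qed

lemma lint_cmult:
  assumes "0 < c" "\<phi> \<in> borel_measurable borel"
  shows "lint p q (\<lambda>t. ennreal c * \<phi> t) = ennreal (c powr q) * lint p q \<phi>"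
proof -
  have [measurable]: "\<phi> \<in> borel_measurable borel" by fact
  show ?thesis
  unfolding lint_def using assms
  by (subst nn_integral_cmult[symmetric]) (auto simp: epow_cmult mult.assoc)
qed

text \<open>The measure \<open>t powr (q / p) dt / t\<close> is homogeneous of degree
  \<open>q / p\<close>; substitution leaves exactly this factor.\<close>

lemma lint_scale:
  assumes c: "0 < c" and "\<phi> \<in> borel_measurable borel"
  shows "lint p q (\<lambda>t. \<phi> (c * t)) = ennreal (c powr (- (q / p))) * lint p q \<phi>"
proof -
  have [measurable]: "\<phi> \<in> borel_measurable borel" by fact
  have "lint p q \<phi> = ennreal \<bar>c\<bar> * (\<integral>\<^sup>+t. epow (\<phi> (0 + c * t)) q * ennreal ((0 + c * t) powr (q / p - 1)) * indicator {0<..} (0 + c * t) \<partial>lborel)"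
    unfolding lint_def using c by (intro nn_integral_real_affine) auto
  also have "\<dots> = ennreal c * (\<integral>\<^sup>+t. ennreal (c powr (q / p - 1)) * (epow (\<phi> (c * t)) q * ennreal (t powr (q / p - 1)) * indicator {0<..} t) \<partial>lborel)"
  proof -
    have "epow (\<phi> (0 + c * t)) q * ennreal ((0 + c * t) powr (q / p - 1)) * indicator {0<..} (0 + c * t)
        = ennreal (c powr (q / p - 1)) * (epow (\<phi> (c * t)) q * ennreal (t powr (q / p - 1)) * indicator {0<..} t)" for t
      using c by (auto simp: powr_mult ennreal_mult mult_ac zero_less_mult_iff split: split_indicator)
    then show ?thesis using c by simp
  qed
  also have "\<dots> = ennreal c * ennreal (c powr (q / p - 1)) * lint p q (\<lambda>t. \<phi> (c * t))"
    unfolding lint_def by (subst nn_integral_cmult) (auto simp: mult.assoc)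
  also have "ennreal c * ennreal (c powr (q / p - 1)) = ennreal (c powr (q / p))"
    using c by (simp add: powr_diff flip: ennreal_mult)
  finally show ?thesis
    using c by (simp add: mult.assoc[symmetric] flip: ennreal_mult powr_add)
qed

lemma lint_add_finite:
  assumes "0 < q" "\<phi> \<in> borel_measurable borel" "\<psi> \<in> borel_measurable borel"
    "lint p q \<phi> < \<infinity>" "lint p q \<psi> < \<infinity>"
  shows "lint p q (\<lambda>t. \<phi> t + \<psi> t) < \<infinity>"
proof -
  note [measurable] = assms(2,3)
  have "lint p q (\<lambda>t. \<phi> t + \<psi> t) \<le> (\<integral>\<^sup>+t. ennreal (2 powr q) * ((epow (\<phi> t) q * ennreal (t powr (q / p - 1))) * indicator {0<..} t +
     (epow (\<psi> t) q * ennreal (t powr (q / p - 1))) * indicator {0<..} t) \<partial>lborel)"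
    unfolding lint_def using epow_plus_le[OF assms(1)]
    by (intro nn_integral_mono) (auto split: split_indicator intro!: mult_right_mono simp flip: mult.assoc distrib_right)
  also have "\<dots> = ennreal (2 powr q) * (lint p q \<phi> + lint p q \<psi>)"
    unfolding lint_def by (subst nn_integral_cmult, measurable) (subst nn_integral_add, auto)
  also have "\<dots> < \<infinity>" using assms by (simp add: ennreal_mult_less_top)
  finally show ?thesis .
qed

text \<open>On the interval from 0 to \<open>u\<close> the function is at least its value at
  \<open>u\<close>, and the rest is the mass of the weight there. The integral is kept over this
  interval because \<open>lint_tail\<close> uses that it vanishes as \<open>u\<close> tends to
  0.\<close>

lemma lint_pointwise:
  assumes "0 < p" "0 < q" "antimono \<phi>" "0 < u"
  shows "epow (\<phi> u) q * ennreal (u powr (q / p) * (p / q))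
     \<le> (\<integral>\<^sup>+t\<in>{0<..<u}. epow (\<phi> t) q * ennreal (t powr (q / p - 1)) \<partial>lborel)"
proof -
  have "epow (\<phi> u) q * ennreal (u powr (q / p) * (p / q)) = epow (\<phi> u) q * (\<integral>\<^sup>+t\<in>{0<..<u}. ennreal (t powr (q / p - 1)) \<partial>lborel)"
    using nn_integral_powr[of "q / p" u] assms by simp
  also have "\<dots> = (\<integral>\<^sup>+t. epow (\<phi> u) q * (ennreal (t powr (q / p - 1)) * indicator {0<..<u} t) \<partial>lborel)"
    by (subst nn_integral_cmult) auto
  also have "\<dots> \<le> (\<integral>\<^sup>+t\<in>{0<..<u}. epow (\<phi> t) q * ennreal (t powr (q / p - 1)) \<partial>lborel)"
    using assms(2,3) by (intro nn_integral_mono) (auto split: split_indicator intro!: mult_right_mono epow_mono simp: antimono_def)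
  finally show ?thesis .
qed

lemma lint_pointwise':
  assumes "0 < p" "0 < q" "antimono \<phi>" "0 < u"
  shows "epow (\<phi> u) q * ennreal (u powr (q / p) * (p / q)) \<le> lint p q \<phi>"
  using lint_pointwise[OF assms] unfolding lint_def
  by (rule order_trans) (auto intro!: nn_integral_mono split: split_indicator)

text \<open>With \<open>u = \<delta> / Suc n\<close> the left-hand side is a constant multiple of
  \<open>u powr (1 / p) * \<phi> u\<close>, whose q-th power is controlled by the integral over
  \<open>{0<..<u}\<close>. These integrals tend to 0 because the whole one is finite. If \<phi> is a
  rearrangement, the left-hand side is the rearrangement at \<delta> of the dilate by
  \<open>1 / Suc n\<close>.\<close>

lemma lint_tail:
  assumes "0 < p" "0 < q" "antimono \<phi>" "lint p q \<phi> < \<infinity>" "0 < \<epsilon>" "0 < \<delta>"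
  shows "\<forall>\<^sub>F n in sequentially. ennreal (real (Suc n) powr (- (1 / p))) * \<phi> (\<delta> / real (Suc n)) \<le> ennreal \<epsilon>"
proof -
  have [measurable]: "\<phi> \<in> borel_measurable borel" using assms antimono_measurable by auto
  define G where "G = (\<lambda>n t. epow (\<phi> t) q * ennreal (t powr (q / p - 1)) * indicator {0<..<\<delta> / real (Suc n)} t)"
  have "(INF n. integral\<^sup>N lborel (G n)) = (\<integral>\<^sup>+t. (INF n. G n t) \<partial>lborel)"
  proof (rule nn_integral_monotone_convergence_INF_decseq[symmetric])
    show "decseq G"
      unfolding monotone_on_def G_def le_fun_def
    proof (intro ballI allI impI)
      fix m n :: nat and t assume "m \<le> n"
      then have "\<delta> / real (Suc n) \<le> \<delta> / real (Suc m)" using assms(6) by (simp add: frac_le)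
      then show "epow (\<phi> t) q * ennreal (t powr (q / p - 1)) * indicator {0<..<\<delta> / real (Suc n)} t \<le>
        epow (\<phi> t) q * ennreal (t powr (q / p - 1)) * indicator {0<..<\<delta> / real (Suc m)} t"
        by (intro mult_left_mono) (auto split: split_indicator)
    qed
    show "G n \<in> borel_measurable lborel" for n unfolding G_def by measurable
    have "integral\<^sup>N lborel (G 0) \<le> lint p q \<phi>"
      unfolding lint_def G_def by (auto intro!: nn_integral_mono split: split_indicator)
    then show "integral\<^sup>N lborel (G 0) < \<infinity>" using assms by auto
  qed
  also have "\<dots> = (\<integral>\<^sup>+t. 0 \<partial>(lborel::real measure))"
  proof (rule nn_integral_cong)
    fix t :: real
    show "(INF n. G n t) = 0"
    proof (cases "0 < t")
      case True
      obtain n :: nat where "\<delta> / t < real n" using reals_Archimedean2 by blast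
      then have "\<delta> / real (Suc n) < t" using True assms(6) by (simp add: field_simps)
      then have "G n t = 0" unfolding G_def by simp
      then show ?thesis by (metis INF_lower UNIV_I le_zero_eq)
    qed (simp add: G_def)
  qed
  finally have 0: "(INF n. integral\<^sup>N lborel (G n)) = 0" by simp
  \<comment> \<open>\<open>K\<close> is what remains of the mass of the weight on
    \<open>{0<..<\<delta> / k}\<close> after splitting off \<open>k powr (- (q / p))\<close>. The
    threshold \<open>e\<close> is chosen so that cancelling \<open>K\<close> leaves
    \<open>\<epsilon> powr q\<close>.\<close>
  define K where "K = \<delta> powr (q / p) * (p / q)"
  define e where "e = \<epsilon> powr q * K"
  have K: "0 < K" unfolding K_def using assms by simp
  then have "0 < e" unfolding e_def using assms by simp
  then have "(INF n. integral\<^sup>N lborel (G n)) < ennreal e" using 0 by simp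
  then obtain N where N: "integral\<^sup>N lborel (G N) < ennreal e" by (auto simp: INF_less_iff)
  show ?thesis
    unfolding eventually_sequentially
  proof (intro exI[of _ N] allI impI)
    fix n assume "N \<le> n"
    define k where "k = real (Suc n)"
    have k: "0 < k" by (simp add: k_def)
    have le: "\<delta> / k \<le> \<delta> / real (Suc N)" unfolding k_def using assms(6) \<open>N \<le> n\<close> by (simp add: frac_le)
    have "epow (\<phi> (\<delta> / k)) q * ennreal ((\<delta> / k) powr (q / p) * (p / q)) \<le> integral\<^sup>N lborel (G n)"
      using lint_pointwise[OF assms(1-3), of "\<delta> / k"] assms(6) k unfolding G_def k_def by simp
    also have "\<dots> \<le> integral\<^sup>N lborel (G N)"
      unfolding G_def using le by (intro nn_integral_mono mult_left_mono) (auto split: split_indicator simp: k_def)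
    also have "\<dots> < ennreal e" by fact
    finally have "epow (\<phi> (\<delta> / k)) q * ennreal ((\<delta> / k) powr (q / p) * (p / q)) < ennreal e" .
    moreover have "(\<delta> / k) powr (q / p) * (p / q) = k powr (- (q / p)) * K"
      unfolding K_def using k assms(6) by (simp add: powr_divide powr_minus field_simps)
    ultimately have A: "epow (\<phi> (\<delta> / k)) q * ennreal (k powr (- (q / p))) * ennreal K
        < ennreal (\<epsilon> powr q) * ennreal K"
      unfolding e_def using K by (simp add: ennreal_mult mult.assoc)
    have "epow (\<phi> (\<delta> / k)) q * ennreal (k powr (- (q / p))) \<le> ennreal (\<epsilon> powr q)"
      using A mult_right_mono[of "ennreal (\<epsilon> powr q)" "epow (\<phi> (\<delta> / k)) q * ennreal (k powr (- (q / p)))" "ennreal K"]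
      by (meson A linear not_le zero_le)
    moreover have "epow (\<phi> (\<delta> / k)) q * ennreal (k powr (- (q / p))) = epow (ennreal (k powr (- (1 / p))) * \<phi> (\<delta> / k)) q"
      using k by (subst epow_cmult) (auto simp: powr_powr mult.commute)
    ultimately have "epow (epow (ennreal (k powr (- (1 / p))) * \<phi> (\<delta> / k)) q) (1/q) \<le> epow (ennreal (\<epsilon> powr q)) (1/q)"
      using assms by (intro epow_mono) auto
    then show "ennreal (real (Suc n) powr (- (1 / p))) * \<phi> (\<delta> / real (Suc n)) \<le> ennreal \<epsilon>"
      using assms unfolding k_def by (simp add: epow_epow epow_ennreal powr_powr)
  qed
qed

subsection \<open>Rearrangements and dilations\<close>

lemma rearr_antimono: "antimono (rearr f)"
  unfolding rearr_def by (intro antimonoI INF_superset_mono) (auto intro: order_trans ennreal_leI)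

lemma rearr_measurable [measurable]: "rearr f \<in> borel_measurable borel"
  by (rule antimono_measurable[OF rearr_antimono])

lemma rearr_le: "0 \<le> s \<Longrightarrow> distrib_fun f s \<le> ennreal t \<Longrightarrow> rearr f t \<le> ennreal s"
  unfolding rearr_def by (rule INF_lower) auto

lemma superlevel_measurable:
  fixes f :: "real \<Rightarrow> real"
  assumes "f \<in> borel_measurable (lebesgue_on {0<..})"
  shows "{x \<in> {0<..}. s < \<bar>f x\<bar>} \<in> sets lebesgue"
proof -
  have "{x \<in> space (lebesgue_on {0<..}). s < \<bar>f x\<bar>} \<in> sets (lebesgue_on {0<..})"
    using assms borel_measurable_less[OF borel_measurable_const, of "\<lambda>x. \<bar>f x\<bar>" "lebesgue_on {0<..}" s] by auto
  then show ?thesis by (simp add: sets_restrict_space_iff space_restrict_space)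
qed

text \<open>A competitor below \<open>s\<close> in the infimum would have a larger level set, of
  measure above \<open>t\<close>. Measurability of \<open>f\<close> is what makes the distribution
  function monotone.\<close>

lemma le_rearr:
  assumes "f \<in> borel_measurable (lebesgue_on {0<..})" "ennreal t < distrib_fun f s"
  shows "ennreal s \<le> rearr f t"
  unfolding rearr_def
proof (rule INF_greatest)
  fix s' assume s': "s' \<in> {s. 0 \<le> s \<and> distrib_fun f s \<le> ennreal t}"
  have "s \<le> s'"
  proof (rule ccontr)
    assume "\<not> s \<le> s'"
    then have "distrib_fun f s \<le> distrib_fun f s'"
      unfolding distrib_fun_def using superlevel_measurable[OF assms(1)] by (intro emeasure_mono) auto
    then show False using assms s' by auto
  qed
  then show "ennreal s \<le> ennreal s'" by (rule ennreal_leI)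
qed

text \<open>Where the sum exceeds \<open>x + y\<close> in modulus, either \<open>u\<close> exceeds
  \<open>x\<close> or \<open>v\<close> exceeds \<open>y\<close>. The levels \<open>x\<close> and
  \<open>y\<close> are taken within \<open>e / 2\<close> of the two infima.\<close>

lemma rearr_add:
  assumes "u \<in> borel_measurable (lebesgue_on {0<..})" "v \<in> borel_measurable (lebesgue_on {0<..})"
    and "0 \<le> s" "0 \<le> t"
  shows "rearr (\<lambda>x. u x + v x) (s + t) \<le> rearr u s + rearr v t"
proof (rule ennreal_le_epsilon)
  fix e :: real assume e: "0 < e" and fin: "rearr u s + rearr v t < top"
  then obtain a b where ab: "rearr u s = ennreal a" "rearr v t = ennreal b" "0 \<le> a" "0 \<le> b"
    by (cases "rearr u s"; cases "rearr v t") auto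
  have "rearr u s < ennreal (a + e / 2)" using ab e by (simp add: ennreal_less_iff)
  then obtain x where x: "0 \<le> x" "distrib_fun u x \<le> ennreal s" "ennreal x < ennreal (a + e / 2)"
    unfolding rearr_def by (auto simp: INF_less_iff)
  have "rearr v t < ennreal (b + e / 2)" using ab e by (simp add: ennreal_less_iff)
  then obtain y where y: "0 \<le> y" "distrib_fun v y \<le> ennreal t" "ennreal y < ennreal (b + e / 2)"
    unfolding rearr_def by (auto simp: INF_less_iff)
  have "distrib_fun (\<lambda>z. u z + v z) (x + y) \<le> emeasure lebesgue ({z \<in> {0<..}. x < \<bar>u z\<bar>} \<union> {z \<in> {0<..}. y < \<bar>v z\<bar>})"
    unfolding distrib_fun_def
    by (intro emeasure_mono sets.Un superlevel_measurable assms) auto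
  also have "\<dots> \<le> distrib_fun u x + distrib_fun v y"
    unfolding distrib_fun_def by (intro emeasure_subadditive superlevel_measurable assms)
  also have "\<dots> \<le> ennreal (s + t)" using x y assms by (simp add: add_mono)
  finally have "rearr (\<lambda>x. u x + v x) (s + t) \<le> ennreal (x + y)"
    using x y by (intro rearr_le) auto
  also have "\<dots> \<le> ennreal (a + b + e)"
    using x y ab e by (intro ennreal_leI) (auto simp: ennreal_less_iff simp del: ennreal_plus)
  finally show "rearr (\<lambda>x. u x + v x) (s + t) \<le> rearr u s + rearr v t + ennreal e"
    using ab e by simp
qed

text \<open>Right-continuity of the rearrangement makes the shifted functions increase to \<^term>\<open>rearr h\<close>.\<close>

lemma lint_rearr_le_shift:
  assumes "0 < q" "h \<in> borel_measurable (lebesgue_on {0<..})"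
    and le: "\<And>n. lint p q (\<lambda>t. rearr h (t + 1 / real (Suc n)) - ennreal (1 / real (Suc n))) \<le> C"
  shows "lint p q (rearr h) \<le> C"
proof -
  define \<phi> where "\<phi> = (\<lambda>n t. rearr h (t + 1 / real (Suc n)) - ennreal (1 / real (Suc n)))"
  have inc: "\<phi> m t \<le> \<phi> n t" if "m \<le> n" for m n t
  proof -
    have "1 / real (Suc n) \<le> 1 / real (Suc m)" using that by (simp add: frac_le)
    then show ?thesis
      unfolding \<phi>_def by (intro ennreal_minus_mono antimonoD[OF rearr_antimono] ennreal_leI) auto
  qed
  have [measurable]: "\<phi> n \<in> borel_measurable borel" for n
    unfolding \<phi>_def by measurable
  have ge: "rearr h t \<le> (SUP n. \<phi> n t)" if "0 < t" for t
  proof (rule ccontr)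
    assume "\<not> ?thesis"
    then have lt: "(SUP n. \<phi> n t) < rearr h t" by simp
    then obtain z where z: "(SUP n. \<phi> n t) < z" "z < rearr h t" using dense by blast
    then obtain s where s: "z = ennreal s" "0 \<le> s" by (cases z) auto
    obtain r where r: "(SUP n. \<phi> n t) = ennreal r" "0 \<le> r" "r < s"
      using z s by (cases "SUP n. \<phi> n t") (auto simp: ennreal_less_iff)
    have "\<not> distrib_fun h s \<le> ennreal t"
      using rearr_le[of s h t] s z by auto
    then have "ennreal t < distrib_fun h s" by simp
    then obtain w where w: "ennreal t < w" "w < distrib_fun h s" using dense by blast
    then obtain t' where t': "w = ennreal t'" "0 \<le> t'" by (cases w) auto
    then have "t < t'" using w that by (simp add: ennreal_less_iff)
    \<comment> \<open>The level set at height \<open>s\<close> has measure strictly above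
      \<open>t\<close>, which leaves room up to \<open>t'\<close>. A shift below \<open>d\<close>
      keeps the argument below \<open>t'\<close> and costs less height than the gap
      \<open>s - r\<close>.\<close>
    define d where "d = min (t' - t) (s - r)"
    have "0 < d" unfolding d_def using \<open>t < t'\<close> r by simp
    then obtain n :: nat where "1 / d < real n" using reals_Archimedean2 by blast
    then have n: "1 / real (Suc n) < d" using \<open>0 < d\<close> by (simp add: field_simps)
    have "ennreal (t + 1 / real (Suc n)) < distrib_fun h s"
      by (rule order.strict_trans1[OF _ w(2)]) (use t' n in \<open>auto simp: d_def intro!: ennreal_leI\<close>)
    then have "ennreal s \<le> rearr h (t + 1 / real (Suc n))" by (rule le_rearr[OF assms(2)])
    then have "ennreal (s - 1 / real (Suc n)) \<le> \<phi> n t"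
      unfolding \<phi>_def by (subst ennreal_minus[symmetric]) (auto intro: ennreal_minus_mono)
    also have "\<dots> \<le> ennreal r" unfolding r(1)[symmetric] by (rule SUP_upper) simp
    finally show False using n r by (simp add: d_def)
  qed
  have "lint p q (rearr h) \<le> lint p q (\<lambda>t. SUP n. \<phi> n t)"
    using ge assms(1) by (intro lint_mono) auto
  also have "\<dots> = (\<integral>\<^sup>+t. (SUP n. epow (\<phi> n t) q * ennreal (t powr (q / p - 1)) * indicator {0<..} t) \<partial>lborel)"
    unfolding lint_def
    by (intro nn_integral_cong) (simp add: epow_SUP[OF assms(1)] SUP_mult_right_ennreal)
  also have "\<dots> = (SUP n. lint p q (\<phi> n))"
    unfolding lint_def
    by (rule nn_integral_monotone_convergence_SUP)
       (auto simp: incseq_def le_fun_def intro!: mult_right_mono epow_mono assms inc)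
  also have "\<dots> \<le> C" using le by (intro SUP_least) (simp add: \<phi>_def)
  finally show ?thesis .
qed

section \<open>Dilations as isometries of the Lorentz spaces\<close>

definition dil :: "real \<Rightarrow> real \<Rightarrow> (real \<Rightarrow> real) \<Rightarrow> real \<Rightarrow> real" where
  "dil p c f x = c powr (1 / p) * f (c * x)"

lemma dil_dil: "0 < a \<Longrightarrow> 0 < b \<Longrightarrow> dil p a (dil p b f) = dil p (a * b) f"
  by (auto simp: dil_def powr_mult mult_ac)

lemma dil_1 [simp]: "dil p 1 f = f"
  by (auto simp: dil_def)

lemma dil_measurable:
  assumes "f \<in> borel_measurable (lebesgue_on {0<..})" "0 < c"
  shows "dil p c f \<in> borel_measurable (lebesgue_on {0<..})"
proof -
  \<comment> \<open>Lebesgue measurability does not survive composition with arbitrary continuous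
    maps. After extension by zero, linear scaling is used as a measurable map of the Lebesgue
    sigma-algebra into itself.\<close>
  have "(\<lambda>x. if x \<in> {0<..} then f x else 0) \<in> borel_measurable lebesgue"
    using assms(1) by (rule borel_measurable_if_I) simp
  from measurable_compose[OF lebesgue_measurable_scaling[of c] this]
  have [measurable]: "(\<lambda>x. if c * x \<in> {0<..} then f (c * x) else 0) \<in> borel_measurable lebesgue"
    unfolding real_scaleR_def .
  have "(\<lambda>x. c powr (1 / p) * (if c * x \<in> {0<..} then f (c * x) else 0)) \<in> borel_measurable lebesgue"
    by measurable
  also have "(\<lambda>x. c powr (1 / p) * (if c * x \<in> {0<..} then f (c * x) else 0)) = (\<lambda>x. if x \<in> {0<..} then dil p c f x else 0)"
    using assms by (auto simp: dil_def zero_less_mult_iff)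
  finally show ?thesis by (rule borel_measurable_if_D)
qed

lemma distrib_fun_dil:
  assumes "0 < c"
  shows "distrib_fun (dil p c f) (c powr (1 / p) * s) = ennreal (1 / c) * distrib_fun f s"
proof -
  have "{x \<in> {0<..}. c powr (1 / p) * s < \<bar>dil p c f x\<bar>} = {x \<in> {0<..}. s < \<bar>f (c * x)\<bar>}"
    using assms by (auto simp: dil_def abs_mult)
  also have "\<dots> = (\<lambda>x. (1 / c) *\<^sub>R x + 0) ` {x \<in> {0<..}. s < \<bar>f x\<bar>}"
  proof (intro set_eqI iffI)
    fix x assume "x \<in> {x \<in> {0<..}. s < \<bar>f (c * x)\<bar>}"
    then show "x \<in> (\<lambda>x. (1 / c) *\<^sub>R x + 0) ` {x \<in> {0<..}. s < \<bar>f x\<bar>}"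
      using assms by (intro image_eqI[of _ _ "c * x"]) auto
  qed (use assms in auto)
  finally show ?thesis
    unfolding distrib_fun_def using assms by (simp only: emeasure_lebesgue_affine) simp
qed

text \<open>Level sets give one inequality, for every factor. The reverse one is the same inequality
  for the factor \<open>1 / c\<close> applied to \<open>dil p c f\<close>.\<close>

lemma rearr_dil:
  assumes "0 < c" "0 < t"
  shows "rearr (dil p c f) t = ennreal (c powr (1 / p)) * rearr f (c * t)"
proof -
  have *: "ennreal (a powr (- (1 / p))) * rearr (dil p a g) u \<le> rearr g (a * u)"
    if "0 < a" "0 < u" for a g u
    unfolding rearr_def[of g]
  proof (rule INF_greatest)
    fix s assume s: "s \<in> {s. 0 \<le> s \<and> distrib_fun g s \<le> ennreal (a * u)}"
    have "distrib_fun (dil p a g) (a powr (1 / p) * s) \<le> ennreal (1 / a) * ennreal (a * u)"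
      unfolding distrib_fun_dil[OF that(1)] using s by (intro mult_left_mono) auto
    also have "\<dots> = ennreal u" using that by (simp flip: ennreal_mult)
    finally have "rearr (dil p a g) u \<le> ennreal (a powr (1 / p) * s)"
      using s by (intro rearr_le) auto
    then have "ennreal (a powr (- (1 / p))) * rearr (dil p a g) u
        \<le> ennreal (a powr (- (1 / p))) * ennreal (a powr (1 / p) * s)"
      by (intro mult_left_mono) auto
    also have "\<dots> = ennreal s"
      using that s by (simp flip: ennreal_mult mult.assoc powr_add)
    finally show "ennreal (a powr (- (1 / p))) * rearr (dil p a g) u \<le> ennreal s" .
  qed
  have inv: "ennreal (c powr (1 / p)) * ennreal (c powr (- (1 / p))) = 1"
    using assms by (simp flip: ennreal_mult powr_add)
  show ?thesis
  proof (rule antisym)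
    have "rearr (dil p c f) t = ennreal (c powr (1 / p)) * (ennreal (c powr (- (1 / p))) * rearr (dil p c f) t)"
      by (simp add: inv flip: mult.assoc)
    also have "\<dots> \<le> ennreal (c powr (1 / p)) * rearr f (c * t)"
      by (intro mult_left_mono * assms) auto
    finally show "rearr (dil p c f) t \<le> \<dots>" .
    show "ennreal (c powr (1 / p)) * rearr f (c * t) \<le> rearr (dil p c f) t"
      using *[of "1 / c" "c * t" "dil p c f"] assms by (simp add: dil_dil powr_divide powr_minus_divide)
  qed
qed

text \<open>The normalization \<open>c powr (1 / p)\<close> in \<open>dil\<close> contributes
  \<open>c powr (q / p)\<close>, which cancels the factor from \<open>lint_scale\<close>, whatever
  the second exponent is.\<close>

lemma lorentz_integral_dil:
  assumes "0 < p" "0 < q" "0 < c"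
  shows "lorentz_integral p q (dil p c f) = lorentz_integral p q f"
proof -
  have "lorentz_integral p q (dil p c f) = lint p q (\<lambda>t. ennreal (c powr (1 / p)) * rearr f (c * t))"
    unfolding lorentz_integral_eq[OF assms(1,2)] using assms by (intro lint_cong rearr_dil) auto
  also have "\<dots> = ennreal ((c powr (1 / p)) powr q) * (ennreal (c powr (- (q / p))) * lint p q (rearr f))"
    using assms by (subst lint_cmult, simp, measurable) (simp add: lint_scale)
  also have "\<dots> = lint p q (rearr f)"
    using assms by (simp add: powr_powr flip: mult.assoc ennreal_mult powr_add)
  finally show ?thesis by (simp add: lorentz_integral_eq[OF assms(1,2)])
qed

lemma lorentz_norm_dil:
  "0 < p \<Longrightarrow> 0 < q \<Longrightarrow> 0 < c \<Longrightarrow> lorentz_norm p q (dil p c f) = lorentz_norm p q f"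
  by (simp add: lorentz_norm_def lorentz_integral_dil)

lemma lorentz_space_dil:
  "0 < p \<Longrightarrow> 0 < q \<Longrightarrow> 0 < c \<Longrightarrow> f \<in> lorentz_space p q \<Longrightarrow> dil p c f \<in> lorentz_space p q"
  by (simp add: lorentz_space_def lorentz_integral_dil dil_measurable)

lemma rearr_uminus: "rearr (\<lambda>x. - f x) = rearr f"
  by (simp add: rearr_def distrib_fun_def fun_eq_iff)

lemma rearr_zero: "0 \<le> t \<Longrightarrow> rearr (\<lambda>x. 0) t = 0"
  using rearr_le[of 0 "\<lambda>x. 0" t] by (simp add: distrib_fun_def)

lemma lorentz_space_zero:
  assumes "0 < p" "0 < q" shows "(\<lambda>x. 0) \<in> lorentz_space p q" "lorentz_norm p q (\<lambda>x. 0) = 0"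
proof -
  have "lint p q (rearr (\<lambda>x. 0)) = lint p q (\<lambda>t. 0)" by (intro lint_cong rearr_zero) auto
  then have "lorentz_integral p q (\<lambda>x. 0) = 0" unfolding lorentz_integral_eq[OF assms] by (simp add: lint_def)
  then show "(\<lambda>x. 0) \<in> lorentz_space p q" "lorentz_norm p q (\<lambda>x. 0) = 0"
    using assms by (auto simp: lorentz_space_def lorentz_norm_def)
qed

text \<open>Since \<open>enn2real\<close> sends infinity to 0, an infinite integral has
  \<open>lorentz_norm\<close> 0. A bound on the norm of a difference is therefore informative only
  once finiteness is known. Splitting \<open>t\<close> into two halves in \<open>rearr_add\<close>
  gives it without a triangle inequality.\<close>

lemma lorentz_integral_diff_finite:
  assumes "0 < p" "0 < q" "f \<in> lorentz_space p q" "g \<in> lorentz_space p q"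
  shows "lorentz_integral p q (\<lambda>x. f x - g x) < \<infinity>"
proof -
  have m: "f \<in> borel_measurable (lebesgue_on {0<..})" "g \<in> borel_measurable (lebesgue_on {0<..})"
    and fin: "lint p q (rearr f) < \<infinity>" "lint p q (rearr g) < \<infinity>"
    using assms(3,4) by (auto simp: lorentz_space_def lorentz_integral_eq[OF assms(1,2)])
  have "lint p q (rearr (\<lambda>x. f x - g x)) \<le> lint p q (\<lambda>t. rearr f (1 / 2 * t) + rearr g (1 / 2 * t))"
  proof (rule lint_mono[OF assms(2)])
    fix t :: real assume "0 < t"
    then show "rearr (\<lambda>x. f x - g x) t \<le> rearr f (1 / 2 * t) + rearr g (1 / 2 * t)"
      using rearr_add[of f "\<lambda>x. - g x" "1 / 2 * t" "1 / 2 * t"] m by (simp add: rearr_uminus)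
  qed
  also have "\<dots> < \<infinity>"
    by (intro lint_add_finite assms; (subst lint_scale)?; (measurable)?)
       (use fin in \<open>auto simp: ennreal_mult_less_top\<close>)
  finally show ?thesis by (simp add: lorentz_integral_eq[OF assms(1,2)])
qed

subsection \<open>The Laplace transform\<close>

text \<open>Fubini and measurability of parameter integrals are applied over \<open>lborel\<close>.
  A Borel function equal to \<open>f\<close> almost everywhere on the half-line leaves the transform
  and the distribution function unchanged.\<close>

lemma laplace_representative:
  assumes "f \<in> borel_measurable (lebesgue_on {0<..})"
  obtains g where "g \<in> borel_measurable borel"
    "\<forall>t. laplace f t = (LINT s|lborel. indicator {0<..} s * (g s * exp (- (t * s))))"
    "\<forall>l. distrib_fun f l = emeasure lborel {s. 0 < s \<and> l < \<bar>g s\<bar>}"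
proof -
  let ?f = "\<lambda>x. if x \<in> {0<..} then f x else 0"
  have fm: "?f \<in> borel_measurable lebesgue"
    using assms by (rule borel_measurable_if_I) simp
  then obtain g where g: "g \<in> borel_measurable lborel" "AE x in lborel. ?f x = g x"
    using completion_ex_borel_measurable_real by blast
  have [measurable]: "g \<in> borel_measurable borel" using g(1) by simp
  have ae: "AE x in lborel. 0 < x \<longrightarrow> f x = g x" using g(2) by eventually_elim auto
  have ae': "AE x in lebesgue. 0 < x \<longrightarrow> f x = g x" using ae by (rule AE_completion)
  show ?thesis
  proof (rule that; (intro allI)?)
    fix t
    have m: "(\<lambda>s. indicator {0<..} s * (g s * exp (- (t * s)))) \<in> borel_measurable lborel" by measurable
    have "(\<lambda>s. indicator {0<..} s * (?f s * exp (- (t * s)))) \<in> borel_measurable lebesgue"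
      by (intro borel_measurable_times fm) (auto intro!: measurable_completion)
    also have "(\<lambda>s. indicator {0<..} s * (?f s * exp (- (t * s)))) = (\<lambda>s. indicator {0<..} s *\<^sub>R (f s * exp (- (t * s))))"
      by (auto split: split_indicator)
    finally have "laplace f t = (LINT s|lebesgue. indicator {0<..} s * (g s * exp (- (t * s))))"
      unfolding laplace_def set_lebesgue_integral_def
    proof (rule integral_cong_AE)
      show "(\<lambda>s. indicator {0<..} s * (g s * exp (- (t * s)))) \<in> borel_measurable lebesgue"
        by (rule measurable_completion[OF m])
      show "AE s in lebesgue. indicator {0<..} s *\<^sub>R (f s * exp (- (t * s))) = indicator {0<..} s * (g s * exp (- (t * s)))"
        using ae' by eventually_elim (auto split: split_indicator)
    qed
    also have "\<dots> = (LINT s|lborel. indicator {0<..} s * (g s * exp (- (t * s))))"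
      by (rule integral_completion[OF m])
    finally show "laplace f t = (LINT s|lborel. indicator {0<..} s * (g s * exp (- (t * s))))" .
  next
    fix l
    have "distrib_fun f l = emeasure lebesgue {s. 0 < s \<and> l < \<bar>g s\<bar>}"
      unfolding distrib_fun_def
      by (intro emeasure_eq_AE superlevel_measurable assms) (use ae' in auto)
    then show "distrib_fun f l = emeasure lborel {s. 0 < s \<and> l < \<bar>g s\<bar>}" by simp
  qed simp
qed

lemma laplace_measurable:
  assumes "f \<in> borel_measurable (lebesgue_on {0<..})"
  shows "laplace f \<in> borel_measurable (lebesgue_on {0<..})"
proof -
  obtain g where [measurable]: "g \<in> borel_measurable borel"
    and eq: "\<forall>t. laplace f t = (LINT s|lborel. indicator {0<..} s * (g s * exp (- (t * s))))"
    by (rule laplace_representative[OF assms])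
  have "(\<lambda>t. LINT s|lborel. indicator {0<..} s * (g s * exp (- (t * s)))) \<in> borel_measurable lborel"
    by measurable
  moreover have "laplace f = (\<lambda>t. LINT s|lborel. indicator {0<..} s * (g s * exp (- (t * s))))"
    using eq by auto
  ultimately have "laplace f \<in> borel_measurable lborel" by simp
  then show ?thesis by (intro measurable_restrict_space1 measurable_completion)
qed

text \<open>Substitution in the integral produces a factor \<open>c\<close>, and
  \<open>1/p + 1/p' = 1\<close> turns \<open>c\<close> times \<open>c powr (- (1/p))\<close> into
  the normalization for p'. Stretching \<open>f\<close> thus compresses its transform.\<close>

lemma laplace_dil:
  assumes "f \<in> borel_measurable (lebesgue_on {0<..})" "0 < c" "p \<noteq> 0" "p \<noteq> 1"
  shows "laplace (dil p (1 / c) f) = dil (p / (p - 1)) c (laplace f)"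
proof
  fix t
  let ?F = "\<lambda>s. indicator {0<..} s *\<^sub>R (f s * exp (- (c * t * s)))"
  have fm: "(\<lambda>x. if x \<in> {0<..} then f x else 0) \<in> borel_measurable lebesgue"
    using assms(1) by (rule borel_measurable_if_I) simp
  have "(\<lambda>s. (if s \<in> {0<..} then f s else 0) * exp (- (c * t * s))) \<in> borel_measurable lebesgue"
    by (intro borel_measurable_times fm) (auto intro!: measurable_completion)
  also have "(\<lambda>s. (if s \<in> {0<..} then f s else 0) * exp (- (c * t * s))) = ?F"
    by (auto split: split_indicator)
  finally have Fm [measurable]: "?F \<in> borel_measurable lebesgue" .
  have cm [measurable]: "(\<lambda>x. 0 + 1 / c * x) \<in> lebesgue \<rightarrow>\<^sub>M lebesgue"
  proof -
    have "(\<lambda>x. 0 + 1 / c * x) = (*\<^sub>R) (1 / c)" by auto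
    then show ?thesis using lebesgue_measurable_scaling by metis
  qed
  have "laplace f (c * t) = (LINT s|density (distr lebesgue lebesgue (\<lambda>x. 0 + 1 / c * x)) (\<lambda>_. ennreal \<bar>1 / c\<bar>). ?F s)"
    unfolding laplace_def set_lebesgue_integral_def
    using lebesgue_real_affine[of "1 / c" 0] assms(2) by simp
  also have "\<dots> = (LINT s|distr lebesgue lebesgue (\<lambda>x. 0 + 1 / c * x). \<bar>1 / c\<bar> *\<^sub>R ?F s)"
    by (rule integral_density) (use Fm in simp_all)
  also have "\<dots> = (LINT s|lebesgue. \<bar>1 / c\<bar> *\<^sub>R ?F (0 + 1 / c * s))"
    by (rule integral_distr[OF cm]) measurable
  also have "\<dots> = (LINT s|lebesgue. (1 / c) * (indicator {0<..} s * (f (1 / c * s) * exp (- (t * s)))))"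
    using assms(2) by (intro Bochner_Integration.integral_cong) (auto split: split_indicator simp: zero_less_divide_iff)
  finally have "laplace f (c * t) = (1 / c) * (LINT s|lebesgue. indicator {0<..} s * (f (1 / c * s) * exp (- (t * s))))"
    by simp
  moreover have "laplace (dil p (1 / c) f) t = (1 / c) powr (1 / p) * (LINT s|lebesgue. indicator {0<..} s * (f (1 / c * s) * exp (- (t * s))))"
    unfolding laplace_def dil_def set_lebesgue_integral_def
    by (subst integral_mult_right_zero[symmetric]) (simp add: mult_ac)
  moreover have "(1 / c) powr (1 / p) = c powr (1 / (p / (p - 1))) * (1 / c)"
    using assms by (simp add: powr_divide diff_divide_distrib powr_diff)
  ultimately show "laplace (dil p (1 / c) f) t = dil (p / (p - 1)) c (laplace f) t"
    by (simp add: dil_def)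
qed

section \<open>Pointwise bound of the Laplace transform by the rearrangement\<close>

lemma nn_integral_layer_le: "(\<integral>\<^sup>+l. indicator {l. 0 < l \<and> ennreal l \<le> x} l \<partial>lborel) \<le> x"
proof (cases x)
  case (real r)
  have "{l. 0 < l \<and> ennreal l \<le> x} = {0<..r}" using real by auto
  then show ?thesis using real by simp
qed simp

lemma nn_integral_exp_le:
  assumes "0 < t"
  shows "(\<integral>\<^sup>+s\<in>{0<..}. ennreal (exp (- (t * s))) \<partial>lborel) \<le> ennreal (1 / t)"
proof -
  have "((\<lambda>s. exp (- t * s)) has_integral exp (- t * 0) / t) {0..}"
    by (rule has_integral_exp_minus_to_infinity[OF assms])
  from nn_integral_has_integral_lebesgue'[OF _ this]
  have "(\<integral>\<^sup>+s\<in>{0..}. ennreal (exp (- t * s)) \<partial>lborel) = ennreal (1 / t)" by simp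
  moreover have "(\<integral>\<^sup>+s\<in>{0<..}. ennreal (exp (- (t * s))) \<partial>lborel) \<le> (\<integral>\<^sup>+s\<in>{0..}. ennreal (exp (- t * s)) \<partial>lborel)"
    by (intro nn_integral_mono) (auto split: split_indicator)
  ultimately show ?thesis by simp
qed

text \<open>Layer cake: on a level set \<open>E\<close> the integral of \<open>exp (- t s)\<close> is at most \<open>min |E| (1 / t)\<close>,
  and this is the measure of the part of \<open>{0<..<1 / t}\<close> where the rearrangement exceeds the level.\<close>

lemma laplace_le_rearr:
  assumes "f \<in> borel_measurable (lebesgue_on {0<..})" "0 < t"
  shows "ennreal \<bar>laplace f t\<bar> \<le> (\<integral>\<^sup>+s\<in>{0<..<1 / t}. rearr f s \<partial>lborel)"
proof -
  obtain g where [measurable]: "g \<in> borel_measurable borel"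
    and eq: "\<forall>t. laplace f t = (LINT s|lborel. indicator {0<..} s * (g s * exp (- (t * s))))"
    and d: "\<forall>l. distrib_fun f l = emeasure lborel {s. 0 < s \<and> l < \<bar>g s\<bar>}"
    by (rule laplace_representative[OF assms(1)])
  note eq = eq[rule_format]
  have "ennreal \<bar>laplace f t\<bar> \<le> (\<integral>\<^sup>+s. ennreal (norm (indicator {0<..} s * (g s * exp (- (t * s))))) \<partial>lborel)"
  proof (cases "integrable lborel (\<lambda>s. indicator {0<..} s * (g s * exp (- (t * s))))")
    case True
    from integral_norm_bound_ennreal[OF this] show ?thesis unfolding eq real_norm_def .
  next
    \<comment> \<open>The Bochner integral of a non-integrable function is 0 by convention, so the
      bound is trivial here.\<close>
    case False
    then have "laplace f t = 0" unfolding eq by (rule not_integrable_integral_eq)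
    then show ?thesis by simp
  qed
  \<comment> \<open>Writing \<open>\<bar>g s\<bar>\<close> as the length of its set of levels gives
    a double integral, which can be estimated level by level after exchanging the order.\<close>
  also have "\<dots> = (\<integral>\<^sup>+s. (\<integral>\<^sup>+l. ennreal (exp (- (t * s))) * indicator {0<..} s * (indicator {0<..} l * indicator {..<\<bar>g s\<bar>} l) \<partial>lborel) \<partial>lborel)"
  proof (rule nn_integral_cong)
    fix s :: real
    have *: "indicator {0<..} l * indicator {..<\<bar>g s\<bar>} l = (indicator {0<..<\<bar>g s\<bar>} l :: ennreal)" for l
      by (auto split: split_indicator)
    have "(\<integral>\<^sup>+l. ennreal (exp (- (t * s))) * indicator {0<..} s * (indicator {0<..} l * indicator {..<\<bar>g s\<bar>} l) \<partial>lborel)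
        = ennreal (exp (- (t * s))) * indicator {0<..} s * ennreal \<bar>g s\<bar>"
      unfolding * by (subst nn_integral_cmult) auto
    also have "\<dots> = ennreal (norm (indicator {0<..} s * (g s * exp (- (t * s)))))"
      by (auto simp: abs_mult mult.commute split: split_indicator simp flip: ennreal_mult)
    finally show "ennreal (norm (indicator {0<..} s * (g s * exp (- (t * s))))) =
      (\<integral>\<^sup>+l. ennreal (exp (- (t * s))) * indicator {0<..} s * (indicator {0<..} l * indicator {..<\<bar>g s\<bar>} l) \<partial>lborel)" ..
  qed
  also have "\<dots> = (\<integral>\<^sup>+s. (\<integral>\<^sup>+l. (if 0 < s \<and> 0 < l \<and> l < \<bar>g s\<bar> then ennreal (exp (- (t * s))) else 0) \<partial>lborel) \<partial>lborel)"
    by (intro nn_integral_cong) auto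
  also have "\<dots> = (\<integral>\<^sup>+l. (\<integral>\<^sup>+s. (if 0 < s \<and> 0 < l \<and> l < \<bar>g s\<bar> then ennreal (exp (- (t * s))) else 0) \<partial>lborel) \<partial>lborel)"
    by (rule lborel_pair.Fubini') measurable
  \<comment> \<open>The level condition on the right is non-strict because \<open>le_rearr\<close>
    gives only a non-strict bound.\<close>
  also have "\<dots> \<le> (\<integral>\<^sup>+l. (\<integral>\<^sup>+s. indicator {0<..<1 / t} s * indicator {l. 0 < l \<and> ennreal l \<le> rearr f s} l \<partial>lborel) \<partial>lborel)"
  proof (rule nn_integral_mono)
    fix l :: real
    show "(\<integral>\<^sup>+s. (if 0 < s \<and> 0 < l \<and> l < \<bar>g s\<bar> then ennreal (exp (- (t * s))) else 0) \<partial>lborel)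
      \<le> (\<integral>\<^sup>+s. indicator {0<..<1 / t} s * indicator {l. 0 < l \<and> ennreal l \<le> rearr f s} l \<partial>lborel)"
    proof (cases "0 < l")
      case l: True
      have le1: "(\<integral>\<^sup>+s. (if 0 < s \<and> 0 < l \<and> l < \<bar>g s\<bar> then ennreal (exp (- (t * s))) else 0) \<partial>lborel) \<le> ennreal (1 / t)"
        by (rule order_trans[OF _ nn_integral_exp_le[OF assms(2)]]) (auto intro!: nn_integral_mono split: split_indicator)
      have "(\<integral>\<^sup>+s. (if 0 < s \<and> 0 < l \<and> l < \<bar>g s\<bar> then ennreal (exp (- (t * s))) else 0) \<partial>lborel)
         \<le> (\<integral>\<^sup>+s. indicator {s. 0 < s \<and> l < \<bar>g s\<bar>} s \<partial>lborel)"
        using assms(2) by (intro nn_integral_mono) (auto split: split_indicator)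
      also have "\<dots> = distrib_fun f l" by (simp add: d)
      finally have "(\<integral>\<^sup>+s. (if 0 < s \<and> 0 < l \<and> l < \<bar>g s\<bar> then ennreal (exp (- (t * s))) else 0) \<partial>lborel)
         \<le> min (ennreal (1 / t)) (distrib_fun f l)" using le1 by simp
      also have "\<dots> \<le> (\<integral>\<^sup>+s. indicator {0<..<1 / t} s * indicator {l. 0 < l \<and> ennreal l \<le> rearr f s} l \<partial>lborel)"
      proof -
        obtain m where m: "0 \<le> m" "ennreal m = min (ennreal (1 / t)) (distrib_fun f l)"
          by (cases "min (ennreal (1 / t)) (distrib_fun f l)") (auto simp: min_def split: if_splits)
        have "ennreal m \<le> ennreal (1 / t)" by (simp add: m(2))
        then have m': "m \<le> 1 / t" using assms(2) by (subst (asm) ennreal_le_iff) auto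
        have m'': "ennreal m \<le> distrib_fun f l" by (simp add: m(2))
        have "ennreal m = (\<integral>\<^sup>+s. indicator {0<..<m} s \<partial>lborel)" using m by simp
        also have "\<dots> \<le> (\<integral>\<^sup>+s. indicator {0<..<1 / t} s * indicator {l. 0 < l \<and> ennreal l \<le> rearr f s} l \<partial>lborel)"
        proof (rule nn_integral_mono)
          fix s :: real
          have "ennreal l \<le> rearr f s" if "0 < s" "s < m"
          proof (rule le_rearr[OF assms(1)])
            have "ennreal s < ennreal m" using that by (simp add: ennreal_less_iff)
            then show "ennreal s < distrib_fun f l" using m'' by (rule less_le_trans)
          qed
          then show "indicator {0<..<m} s \<le> (indicator {0<..<1 / t} s * indicator {l. 0 < l \<and> ennreal l \<le> rearr f s} l :: ennreal)"
            using m' l by (auto split: split_indicator)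
        qed
        finally show ?thesis using m by simp
      qed
      finally show ?thesis .
    qed simp
  qed
  also have "\<dots> = (\<integral>\<^sup>+l. (\<integral>\<^sup>+s. (if 0 < s \<and> s < 1 / t \<and> 0 < l \<and> ennreal l \<le> rearr f s then 1 else 0) \<partial>lborel) \<partial>lborel)"
    by (intro nn_integral_cong) auto
  also have "\<dots> = (\<integral>\<^sup>+s. (\<integral>\<^sup>+l. (if 0 < s \<and> s < 1 / t \<and> 0 < l \<and> ennreal l \<le> rearr f s then 1 else 0) \<partial>lborel) \<partial>lborel)"
    by (rule lborel_pair.Fubini') measurable
  also have "\<dots> \<le> (\<integral>\<^sup>+s\<in>{0<..<1 / t}. rearr f s \<partial>lborel)"
  proof (rule nn_integral_mono)
    fix s :: real
    have "(\<integral>\<^sup>+l. (if 0 < s \<and> s < 1 / t \<and> 0 < l \<and> ennreal l \<le> rearr f s then 1 else 0) \<partial>lborel)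
      \<le> (\<integral>\<^sup>+l. indicator {l. 0 < l \<and> ennreal l \<le> rearr f s} l \<partial>lborel)"
      by (intro nn_integral_mono) auto
    then show "(\<integral>\<^sup>+l. (if 0 < s \<and> s < 1 / t \<and> 0 < l \<and> ennreal l \<le> rearr f s then 1 else 0) \<partial>lborel)
       \<le> rearr f s * indicator {0<..<1 / t} s"
      using nn_integral_layer_le[of "rearr f s"] by (auto split: split_indicator intro: order_trans)
  qed
  finally show ?thesis .
qed

subsection \<open>Boundedness\<close>

text \<open>A crude form of Young's inequality: if \<open>z\<close> exceeds \<open>c\<close>, then
  \<open>z = z powr (1 - q) * z powr q\<close>, and the first factor decreases in
  \<open>z\<close>.\<close>

lemma le_epow_plus:
  assumes "1 < q" "0 < c"
  shows "z \<le> ennreal (c powr (1 - q)) * epow z q + ennreal c"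
proof (cases z)
  case (real x)
  have "x \<le> c powr (1 - q) * x powr q + c"
  proof (cases "x \<le> c")
    case False
    then have "x = x powr (1 - q) * x powr q" using assms by (simp flip: powr_add)
    also have "\<dots> \<le> c powr (1 - q) * x powr q"
      using False assms by (intro mult_right_mono powr_mono2') auto
    finally show ?thesis using assms by simp
  qed (use assms in \<open>simp add: add_increasing\<close>)
  then show ?thesis using real assms by (simp add: epow_ennreal flip: ennreal_mult ennreal_plus)
qed (use assms in \<open>simp add: ennreal_mult_top\<close>)

text \<open>Hoelder's inequality against the weight \<open>s powr b\<close>, obtained by integrating
  \<open>z \<le> c powr (1 - q) * z powr q + c\<close> with \<open>c = K * s powr - b\<close> and choosing \<open>K\<close> so that the last term
  contributes half of the left-hand side.\<close>

lemma epow_integral_le: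
  fixes \<phi> :: "real \<Rightarrow> ennreal"
  assumes "1 < q" "b < 1" "0 < x" and [measurable]: "\<phi> \<in> borel_measurable borel"
  shows "epow (\<integral>\<^sup>+s\<in>{0<..<x}. \<phi> s \<partial>lborel) q \<le> ennreal (2 * (2 / (1 - b)) powr (q - 1) * x powr ((1 - b) * (q - 1)))
     * (\<integral>\<^sup>+s\<in>{0<..<x}. ennreal (s powr (b * (q - 1))) * epow (\<phi> s) q \<partial>lborel)"
    (is "epow ?H q \<le> ennreal ?C * ?B")
proof -
  have C: "0 < ?C" using assms by simp
  have main: "?H \<le> ennreal (K powr (1 - q)) * ?B + ennreal (K * (x powr (1 - b) / (1 - b)))" if K: "0 < K" for K
  proof -
    have "?H \<le> (\<integral>\<^sup>+s. ennreal (K powr (1 - q)) * (ennreal (s powr (b * (q - 1))) * epow (\<phi> s) q * indicator {0<..<x} s)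
       + ennreal K * (ennreal (s powr ((1 - b) - 1)) * indicator {0<..<x} s) \<partial>lborel)"
    proof (rule nn_integral_mono)
      fix s :: real
      show "\<phi> s * indicator {0<..<x} s \<le> ennreal (K powr (1 - q)) * (ennreal (s powr (b * (q - 1))) * epow (\<phi> s) q * indicator {0<..<x} s)
         + ennreal K * (ennreal (s powr ((1 - b) - 1)) * indicator {0<..<x} s)"
      proof (cases "s \<in> {0<..<x}")
        case True
        then have s: "0 < s" by simp
        have "(K * s powr (- b)) powr (1 - q) = K powr (1 - q) * s powr (b * (q - 1))"
          using K s by (simp add: powr_mult powr_powr algebra_simps)
        then show ?thesis
          using le_epow_plus[OF assms(1), of "K * s powr (- b)" "\<phi> s"] K s True
          by (simp add: ennreal_mult mult.assoc)
      qed simp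
    qed
    also have "\<dots> = ennreal (K powr (1 - q)) * ?B + ennreal K * (\<integral>\<^sup>+s\<in>{0<..<x}. ennreal (s powr ((1 - b) - 1)) \<partial>lborel)"
      by (subst nn_integral_add, measurable) (simp add: nn_integral_cmult)
    also have "(\<integral>\<^sup>+s\<in>{0<..<x}. ennreal (s powr ((1 - b) - 1)) \<partial>lborel) = ennreal (x powr (1 - b) / (1 - b))"
      using assms by (intro nn_integral_powr) auto
    finally show ?thesis using K by (simp only: ennreal_mult'[OF less_imp_le[OF K]])
  qed
  show ?thesis
  proof (cases ?B)
    case top
    then show ?thesis using C assms by (simp add: ennreal_mult_top)
  next
    case (real \<beta>)
    \<comment> \<open>Finiteness is needed to absorb half of the left-hand side below; any positive
      \<open>K\<close> would show it.\<close>
    have "?H \<noteq> \<infinity>" using main[of 1] real by (auto simp: top_unique simp flip: ennreal_mult)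
    then obtain h where h: "?H = ennreal h" "0 \<le> h" by (cases ?H) auto
    show ?thesis
    proof (cases "h = 0")
      case False
      define X where "X = x powr (1 - b)"
      have X: "0 < X" using assms by (simp add: X_def)
      define K where "K = (h * (1 - b)) / (2 * X)"
      have K: "0 < K" unfolding K_def using False h assms X by simp
      have "ennreal h \<le> ennreal (K powr (1 - q) * \<beta> + K * (X / (1 - b)))"
        using main[OF K] h real K assms X by (simp add: ennreal_mult' X_def)
      then have "h \<le> K powr (1 - q) * \<beta> + K * (X / (1 - b))"
        using K X assms real by (subst (asm) ennreal_le_iff) auto
      moreover have "K * (X / (1 - b)) = h / 2" unfolding K_def using X assms by (simp add: field_simps)
      ultimately have "h / 2 \<le> K powr (1 - q) * \<beta>" by simp
      then have "K powr (q - 1) * (h / 2) \<le> K powr (q - 1) * (K powr (1 - q) * \<beta>)"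
        by (intro mult_left_mono) auto
      also have "\<dots> = \<beta>" using K by (simp flip: mult.assoc powr_add)
      finally have "K powr (q - 1) * (h / 2) \<le> \<beta>" .
      moreover have "K powr (q - 1) = h powr (q - 1) / ((2 / (1 - b)) powr (q - 1) * X powr (q - 1))"
        unfolding K_def using h assms X by (simp add: powr_divide powr_mult)
      ultimately have "h powr (q - 1) * h \<le> (2 * (2 / (1 - b)) powr (q - 1) * X powr (q - 1)) * \<beta>"
        using X assms by (simp add: field_simps)
      moreover have "h powr (q - 1) * h = h powr q"
        using h False by (simp add: powr_diff)
      moreover have "X powr (q - 1) = x powr ((1 - b) * (q - 1))"
        unfolding X_def by (simp add: powr_powr)
      ultimately have "h powr q \<le> ?C * \<beta>" by simp
      then show ?thesis unfolding h(1) real(2) using h real C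
        by (simp add: epow_ennreal ennreal_leI flip: ennreal_mult)
    qed (use h in simp)
  qed
qed

text \<open>\<open>epow_integral_le\<close> at \<open>x = 1 / t\<close> moves the power inside the
  integral at the price of a power weight. Exchanging the integrals then leaves an elementary power
  integral in \<open>t\<close>.\<close>

lemma hardy:
  assumes "1 < p" "1 < q"
  obtains C where "0 \<le> C" "\<And>\<phi>. \<phi> \<in> borel_measurable borel \<Longrightarrow>
    lint (p / (p - 1)) q (\<lambda>t. \<integral>\<^sup>+s\<in>{0<..<1 / t}. \<phi> s \<partial>lborel) \<le> ennreal C * lint p q \<phi>"
proof -
  \<comment> \<open>Two conditions are required: \<open>b < 1\<close>, so that
    \<open>s powr (- b)\<close> is integrable at 0, and \<open>b > (q / p - 1) / (q - 1)\<close>,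
    which is \<open>\<beta> > 0\<close> and makes \<open>t powr (\<beta> - 1)\<close> integrable at
    0. As \<open>p > 1\<close>, the range is nonempty; \<open>b\<close> is its midpoint.\<close>
  define b where "b = (1 + (q / p - 1) / (q - 1)) / 2"
  define \<beta> where "\<beta> = 1 - q / p + b * (q - 1)"
  have "q / p < q" using assms by (simp add: field_simps)
  then have b: "b < 1" unfolding b_def using assms by (simp add: field_simps)
  have "b * (q - 1) = (q - 1 + (q / p - 1)) / 2" unfolding b_def using assms by (simp add: field_simps)
  then have \<beta>: "0 < \<beta>" unfolding \<beta>_def using \<open>q / p < q\<close> by simp
  define A where "A = 2 * (2 / (1 - b)) powr (q - 1)"
  have A: "0 \<le> A" unfolding A_def by simp
  show ?thesis
  proof (rule that[of "A / \<beta>"])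
    show "0 \<le> A / \<beta>" using A \<beta> by simp
    fix \<phi> :: "real \<Rightarrow> ennreal"
    assume [measurable]: "\<phi> \<in> borel_measurable borel"
    define w where "w = (\<lambda>s. ennreal (s powr (b * (q - 1))) * epow (\<phi> s) q)"
    have [measurable]: "w \<in> borel_measurable borel" unfolding w_def by measurable
    have "lint (p / (p - 1)) q (\<lambda>t. \<integral>\<^sup>+s\<in>{0<..<1 / t}. \<phi> s \<partial>lborel)
      \<le> (\<integral>\<^sup>+t. ennreal A * (\<integral>\<^sup>+s. (if 0 < t \<and> 0 < s \<and> s < 1 / t then w s * ennreal (t powr (\<beta> - 1)) else 0) \<partial>lborel) \<partial>lborel)"
      unfolding lint_def
    proof (rule nn_integral_mono)
      fix t :: real
      show "epow (\<integral>\<^sup>+s\<in>{0<..<1 / t}. \<phi> s \<partial>lborel) q * ennreal (t powr (q / (p / (p - 1)) - 1)) * indicator {0<..} t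
         \<le> ennreal A * (\<integral>\<^sup>+s. (if 0 < t \<and> 0 < s \<and> s < 1 / t then w s * ennreal (t powr (\<beta> - 1)) else 0) \<partial>lborel)"
      proof (cases "0 < t")
        case t: True
        have exps: "- ((1 - b) * (q - 1)) + (q / (p / (p - 1)) - 1) = \<beta> - 1"
          unfolding \<beta>_def using assms by (simp add: field_simps)
        have "(1 / t) powr ((1 - b) * (q - 1)) * t powr (q / (p / (p - 1)) - 1) = t powr (\<beta> - 1)"
          using t by (subst exps[symmetric], subst powr_add) (simp add: powr_divide powr_minus_divide)
        then have e2: "A * (1 / t) powr ((1 - b) * (q - 1)) * t powr (q / (p / (p - 1)) - 1) = A * t powr (\<beta> - 1)"
          by (simp add: mult.assoc)
        have "epow (\<integral>\<^sup>+s\<in>{0<..<1 / t}. \<phi> s \<partial>lborel) q * ennreal (t powr (q / (p / (p - 1)) - 1))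
          \<le> (ennreal (A * (1 / t) powr ((1 - b) * (q - 1))) * (\<integral>\<^sup>+s\<in>{0<..<1 / t}. w s \<partial>lborel)) * ennreal (t powr (q / (p / (p - 1)) - 1))"
          unfolding w_def A_def using epow_integral_le[OF assms(2) b, of "1 / t" \<phi>] t
          by (intro mult_right_mono) auto
        also have "\<dots> = ennreal (A * (1 / t) powr ((1 - b) * (q - 1)) * t powr (q / (p / (p - 1)) - 1)) * (\<integral>\<^sup>+s\<in>{0<..<1 / t}. w s \<partial>lborel)"
          using A by (simp add: ennreal_mult mult_ac)
        also have "\<dots> = ennreal A * (ennreal (t powr (\<beta> - 1)) * (\<integral>\<^sup>+s\<in>{0<..<1 / t}. w s \<partial>lborel))"
          unfolding e2 using A by (simp add: ennreal_mult mult_ac)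
        also have "ennreal (t powr (\<beta> - 1)) * (\<integral>\<^sup>+s\<in>{0<..<1 / t}. w s \<partial>lborel) =
          (\<integral>\<^sup>+s. (if 0 < t \<and> 0 < s \<and> s < 1 / t then w s * ennreal (t powr (\<beta> - 1)) else 0) \<partial>lborel)"
          by (subst nn_integral_cmult[symmetric], measurable) (auto intro!: nn_integral_cong simp: t mult.commute)
        finally show ?thesis using t by simp
      qed simp
    qed
    also have "\<dots> = ennreal A * (\<integral>\<^sup>+t. (\<integral>\<^sup>+s. (if 0 < t \<and> 0 < s \<and> s < 1 / t then w s * ennreal (t powr (\<beta> - 1)) else 0) \<partial>lborel) \<partial>lborel)"
      by (rule nn_integral_cmult) measurable
    also have "(\<integral>\<^sup>+t. (\<integral>\<^sup>+s. (if 0 < t \<and> 0 < s \<and> s < 1 / t then w s * ennreal (t powr (\<beta> - 1)) else 0) \<partial>lborel) \<partial>lborel)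
      = (\<integral>\<^sup>+s. (\<integral>\<^sup>+t. (if 0 < t \<and> 0 < s \<and> s < 1 / t then w s * ennreal (t powr (\<beta> - 1)) else 0) \<partial>lborel) \<partial>lborel)"
      by (rule lborel_pair.Fubini') measurable
    \<comment> \<open>For fixed \<open>s\<close> the variable \<open>t\<close> runs over
      \<open>{0<..<1 / s}\<close>. The resulting power \<open>s powr (- \<beta>)\<close> combines
      with the weight in \<open>w\<close> to the Lorentz weight, by the choice of \<beta>.\<close>
    also have "\<dots> = (\<integral>\<^sup>+s. ennreal (1 / \<beta>) * (epow (\<phi> s) q * ennreal (s powr (q / p - 1)) * indicator {0<..} s) \<partial>lborel)"
    proof (rule nn_integral_cong)
      fix s :: real
      show "(\<integral>\<^sup>+t. (if 0 < t \<and> 0 < s \<and> s < 1 / t then w s * ennreal (t powr (\<beta> - 1)) else 0) \<partial>lborel)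
        = ennreal (1 / \<beta>) * (epow (\<phi> s) q * ennreal (s powr (q / p - 1)) * indicator {0<..} s)"
      proof (cases "0 < s")
        case s: True
        have "(\<integral>\<^sup>+t. (if 0 < t \<and> 0 < s \<and> s < 1 / t then w s * ennreal (t powr (\<beta> - 1)) else 0) \<partial>lborel)
          = (\<integral>\<^sup>+t. w s * (ennreal (t powr (\<beta> - 1)) * indicator {0<..<1 / s} t) \<partial>lborel)"
          using s by (intro nn_integral_cong) (auto simp: field_simps split: split_indicator)
        also have "\<dots> = w s * ennreal ((1 / s) powr \<beta> / \<beta>)"
          using nn_integral_powr[OF \<beta>, of "1 / s"] s by (simp add: nn_integral_cmult)
        also have "\<dots> = epow (\<phi> s) q * ennreal (s powr (b * (q - 1)) * ((1 / s) powr \<beta> / \<beta>))"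
          unfolding w_def using \<beta> by (subst ennreal_mult) (auto simp: mult_ac)
        also have "s powr (b * (q - 1)) * ((1 / s) powr \<beta> / \<beta>) = 1 / \<beta> * s powr (b * (q - 1) - \<beta>)"
          using s by (simp add: powr_diff powr_divide)
        also have "b * (q - 1) - \<beta> = q / p - 1" by (simp add: \<beta>_def)
        finally show ?thesis using s \<beta> by (subst (asm) ennreal_mult) (auto simp: mult_ac)
      qed simp
    qed
    also have "\<dots> = ennreal (1 / \<beta>) * lint p q \<phi>"
      unfolding lint_def by (rule nn_integral_cmult) measurable
    finally show "lint (p / (p - 1)) q (\<lambda>t. \<integral>\<^sup>+s\<in>{0<..<1 / t}. \<phi> s \<partial>lborel) \<le> ennreal (A / \<beta>) * lint p q \<phi>"
      using A \<beta> by (simp add: mult.assoc[symmetric] flip: ennreal_mult)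
  qed
qed

text \<open>The pointwise bound from \<open>lint_pointwise'\<close> controls the surplus power
  \<open>r - q\<close> of \<phi> by a power of \<open>t\<close>, which turns the weight for
  \<open>r\<close> into that for \<open>q\<close>. The summand 1 keeps the constant at least 1 when
  \<open>q = r\<close>, even for \<open>M = 0\<close>, where \<open>powr\<close> gives 0.\<close>

lemma lint_embedding:
  assumes "0 < p" "0 < q" "q \<le> r"
    and \<phi>: "antimono \<phi>" "lint p q \<phi> \<le> ennreal M" and "0 \<le> M"
  shows "lint p r \<phi> \<le> ennreal ((q / p * M) powr ((r - q) / q) + 1) * ennreal M"
proof (cases "q = r")
  case True
  have "lint p r \<phi> \<le> 1 * ennreal M" using True \<phi> by simp
  also have "\<dots> \<le> ennreal ((q / p * M) powr ((r - q) / q) + 1) * ennreal M"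
    by (intro mult_right_mono) auto
  finally show ?thesis .
next
  case False
  then have "q < r" using assms by simp
  have [measurable]: "\<phi> \<in> borel_measurable borel" using \<phi> antimono_measurable by auto
  define D where "D = (q / p * M) powr ((r - q) / q)"
  have pt: "epow (\<phi> t) r * ennreal (t powr (r / p - 1)) \<le> ennreal D * (epow (\<phi> t) q * ennreal (t powr (q / p - 1)))"
    if t: "0 < t" for t
  proof -
    define c where "c = t powr (q / p) * (p / q)"
    have c: "0 < c" unfolding c_def using t assms by simp
    have "epow (\<phi> t) q * ennreal c \<le> ennreal M"
      unfolding c_def using lint_pointwise'[OF assms(1,2) \<phi>(1) t] \<phi>(2) by (rule order_trans)
    then have "epow (\<phi> t) q * ennreal c * ennreal (1 / c) \<le> ennreal M * ennreal (1 / c)"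
      by (intro mult_right_mono) auto
    then have le: "epow (\<phi> t) q \<le> ennreal (M / c)"
      using c assms by (simp add: mult.assoc flip: ennreal_mult)
    have "epow (\<phi> t) r = epow (\<phi> t) q * epow (epow (\<phi> t) q) ((r - q) / q)"
      using assms by (simp add: epow_epow flip: epow_add)
    also have "\<dots> \<le> epow (\<phi> t) q * epow (ennreal (M / c)) ((r - q) / q)"
      using le \<open>q < r\<close> assms by (intro mult_left_mono epow_mono) auto
    also have "epow (ennreal (M / c)) ((r - q) / q) = ennreal (D * t powr ((q - r) / p))"
    proof -
      have "M / c = (q / p * M) * t powr (- (q / p))"
        unfolding c_def using assms t by (simp add: powr_minus_divide field_simps)
      moreover have "t powr (- (q / p) * ((r - q) / q)) = t powr ((q - r) / p)"
        using assms by (intro arg_cong[of _ _ "(powr) t"]) (simp add: field_simps)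
      ultimately have "(M / c) powr ((r - q) / q) = D * t powr ((q - r) / p)"
        unfolding D_def using assms by (simp only: powr_mult powr_powr)
      then show ?thesis using c assms by (simp add: epow_ennreal)
    qed
    finally have "epow (\<phi> t) r * ennreal (t powr (r / p - 1)) \<le>
       epow (\<phi> t) q * ennreal (D * t powr ((q - r) / p)) * ennreal (t powr (r / p - 1))"
      by (intro mult_right_mono) auto
    also have "\<dots> = ennreal D * (epow (\<phi> t) q * ennreal (t powr ((q - r) / p) * t powr (r / p - 1)))"
      by (simp add: D_def ennreal_mult mult_ac)
    also have "t powr ((q - r) / p) * t powr (r / p - 1) = t powr (q / p - 1)"
      using assms by (simp add: diff_divide_distrib flip: powr_add)
    finally show ?thesis .
  qed
  have "lint p r \<phi> \<le> (\<integral>\<^sup>+t. ennreal D * (epow (\<phi> t) q * ennreal (t powr (q / p - 1)) * indicator {0<..} t) \<partial>lborel)"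
    unfolding lint_def by (intro nn_integral_mono) (auto simp: pt split: split_indicator)
  also have "\<dots> = ennreal D * lint p q \<phi>"
    unfolding lint_def by (rule nn_integral_cmult) measurable
  also have "\<dots> \<le> ennreal (D + 1) * ennreal M"
    by (intro mult_mono \<phi> ennreal_leI) auto
  finally show ?thesis unfolding D_def .
qed

text \<open>A nonincreasing majorant \<open>H\<close> forces the set where
  \<open>\<bar>f\<bar>\<close> exceeds \<open>H t\<close> into \<open>{0<..<t}\<close>. This carries
  the pointwise bound on the transform, which need not itself be monotone, over to its
  rearrangement.\<close>

lemma rearr_le_antimono:
  assumes "\<And>t. 0 < t \<Longrightarrow> ennreal \<bar>f t\<bar> \<le> H t" "\<And>s t. 0 < s \<Longrightarrow> s \<le> t \<Longrightarrow> H t \<le> H s" "0 < t"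
  shows "rearr f t \<le> H t"
proof (cases "H t")
  case (real s)
  have "{x \<in> {0<..}. s < \<bar>f x\<bar>} \<subseteq> {0<..<t}"
  proof safe
    fix x assume x: "0 < x" "s < \<bar>f x\<bar>"
    show "x \<in> {0<..<t}"
    proof (rule ccontr)
      assume "x \<notin> {0<..<t}"
      then have "H x \<le> H t" using x assms by auto
      then have "ennreal \<bar>f x\<bar> \<le> ennreal s" using assms(1)[OF x(1)] real by (metis order_trans)
      then show False using x real by (simp add: ennreal_le_iff)
    qed
  qed
  then have "distrib_fun f s \<le> emeasure lebesgue {0<..<t}"
    unfolding distrib_fun_def by (intro emeasure_mono) auto
  then have "rearr f t \<le> ennreal s" using real assms(3) by (intro rearr_le) auto
  then show ?thesis using real by simp
qed simp

text \<open>Finiteness is assumed because an infinite integral would have norm 0.\<close>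

lemma lorentz_integral_le:
  assumes "0 < q" "lorentz_integral p q f < \<infinity>" "lorentz_norm p q f \<le> \<rho>"
  shows "lorentz_integral p q f \<le> ennreal (\<rho> powr q)"
proof -
  obtain I where I: "lorentz_integral p q f = ennreal I" "0 \<le> I"
    using assms(2) by (cases "lorentz_integral p q f") auto
  then have "I powr (1 / q) \<le> \<rho>" using assms(3) by (simp add: lorentz_norm_def)
  then have "(I powr (1 / q)) powr q \<le> \<rho> powr q" using assms by (intro powr_mono2) auto
  then show ?thesis using I assms by (simp add: powr_powr)
qed

text \<open>The bound is on the integral and not on the norm, so that it includes finiteness and
  hence membership of the transform in the target space.\<close>

lemma laplace_bounded:
  assumes "1 < p" "1 < q" "q \<le> r"
  obtains C where "\<And>f. f \<in> lorentz_space p q \<Longrightarrow> lorentz_norm p q f \<le> 1 \<Longrightarrow>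
    lorentz_integral (p / (p - 1)) r (laplace f) \<le> ennreal C"
proof -
  let ?p = "p / (p - 1)"
  have pos: "0 < p" "0 < q" "0 < r" "0 < ?p" using assms by auto
  obtain C where C: "0 \<le> C" "\<And>\<phi>. \<phi> \<in> borel_measurable borel \<Longrightarrow>
    lint ?p q (\<lambda>t. \<integral>\<^sup>+s\<in>{0<..<1 / t}. \<phi> s \<partial>lborel) \<le> ennreal C * lint p q \<phi>"
    using hardy[OF assms(1,2)] by blast
  show ?thesis
  proof (rule that)
    fix f assume f: "f \<in> lorentz_space p q" "lorentz_norm p q f \<le> 1"
    have m: "f \<in> borel_measurable (lebesgue_on {0<..})" using f by (simp add: lorentz_space_def)
    have f1: "lint p q (rearr f) \<le> 1"
      using lorentz_integral_le[OF pos(2), of p f 1] f by (simp add: lorentz_space_def lorentz_integral_eq pos)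
    have "lint ?p q (rearr (laplace f)) \<le> lint ?p q (\<lambda>t. \<integral>\<^sup>+s\<in>{0<..<1 / t}. rearr f s \<partial>lborel)"
    proof (rule lint_mono[OF pos(2)], rule rearr_le_antimono[OF laplace_le_rearr[OF m]])
      fix s t :: real assume "0 < s" "s \<le> t"
      then have "1 / t \<le> 1 / s" by (simp add: frac_le)
      then show "(\<integral>\<^sup>+s\<in>{0<..<1 / t}. rearr f s \<partial>lborel) \<le> (\<integral>\<^sup>+s\<in>{0<..<1 / s}. rearr f s \<partial>lborel)"
        by (intro nn_integral_mono) (auto split: split_indicator)
    qed
    also have "\<dots> \<le> ennreal C * lint p q (rearr f)" by (rule C(2)) measurable
    also have "\<dots> \<le> ennreal C * 1" by (intro mult_left_mono f1) auto
    finally have "lint ?p q (rearr (laplace f)) \<le> ennreal C" by simp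
    from lint_embedding[OF pos(4,2) assms(3) rearr_antimono this C(1)]
    show "lorentz_integral ?p r (laplace f) \<le> ennreal (((q / ?p * C) powr ((r - q) / q) + 1) * C)"
      using C(1) by (simp only: lorentz_integral_eq[OF pos(4,3)] ennreal_mult'')
  qed
qed

subsection \<open>Maximal non-compactness\<close>

text \<open>Dilating by a large factor spreads every element of a finite net out until it is small in measure.\<close>

lemma lorentz_norm_laplace_le_net:
  assumes "1 < p" "1 < q" "q \<le> r" and f: "f \<in> lorentz_space p q" "lorentz_norm p q f \<le> 1"
    and F: "finite F" "F \<subseteq> lorentz_space (p / (p - 1)) r" and "0 < \<rho>"
    and net: "\<And>f. f \<in> lorentz_space p q \<Longrightarrow> lorentz_norm p q f \<le> 1 \<Longrightarrow>
      \<exists>g\<in>F. lorentz_norm (p / (p - 1)) r (\<lambda>t. laplace f t - g t) \<le> \<rho>"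
  shows "lorentz_norm (p / (p - 1)) r (laplace f) \<le> \<rho>"
proof -
  define p' where "p' = p / (p - 1)"
  have pos: "0 < p" "0 < q" "0 < r" "0 < p'" using assms by (auto simp: p'_def)
  obtain C where C: "\<And>f. f \<in> lorentz_space p q \<Longrightarrow> lorentz_norm p q f \<le> 1 \<Longrightarrow>
    lorentz_integral p' r (laplace f) \<le> ennreal C"
    using laplace_bounded[OF assms(1-3)] unfolding p'_def by metis
  have fm: "f \<in> borel_measurable (lebesgue_on {0<..})" using f by (simp add: lorentz_space_def)
  let ?h = "laplace f"
  have hm: "?h \<in> borel_measurable (lebesgue_on {0<..})" by (rule laplace_measurable[OF fm])
  have "lint p' r (rearr ?h) \<le> ennreal (\<rho> powr r)"
  proof (rule lint_rearr_le_shift[OF pos(3) hm])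
    fix n :: nat
    \<comment> \<open>The same \<delta> serves as tolerance in measure and in height, to match the
      shifts in \<open>lint_rearr_le_shift\<close>.\<close>
    define \<delta> where "\<delta> = 1 / real (Suc n)"
    have \<delta>: "0 < \<delta>" by (simp add: \<delta>_def)
    have "\<forall>\<^sub>F k in sequentially. \<forall>g\<in>F. ennreal (real (Suc k) powr (- (1 / p'))) * rearr g (\<delta> / real (Suc k)) \<le> ennreal \<delta>"
    proof (rule eventually_ball_finite[OF F(1)], rule ballI)
      fix g assume "g \<in> F"
      then have "g \<in> lorentz_space p' r" using F(2) unfolding p'_def by blast
      then have "lint p' r (rearr g) < \<infinity>" by (simp add: lorentz_space_def lorentz_integral_eq pos)
      then show "\<forall>\<^sub>F k in sequentially. ennreal (real (Suc k) powr (- (1 / p'))) * rearr g (\<delta> / real (Suc k)) \<le> ennreal \<delta>"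
        by (rule lint_tail[OF pos(4,3) rearr_antimono _ \<delta> \<delta>])
    qed
    \<comment> \<open>The factor must be fixed before the net element is known, since
      \<open>g\<close> below depends on the dilate of \<open>f\<close>. Finiteness of
      \<open>F\<close> provides one \<open>k\<close> for all candidates.\<close>
    then obtain k where k: "\<And>g. g \<in> F \<Longrightarrow> ennreal (real (Suc k) powr (- (1 / p'))) * rearr g (\<delta> / real (Suc k)) \<le> ennreal \<delta>"
      unfolding eventually_sequentially by blast
    define c where "c = real (Suc k)"
    have c: "0 < c" by (simp add: c_def)
    let ?f = "dil p (1 / c) f"
    have f': "?f \<in> lorentz_space p q" "lorentz_norm p q ?f \<le> 1"
      using f c pos by (auto simp: lorentz_space_dil lorentz_norm_dil)
    obtain g where g: "g \<in> F" "lorentz_norm p' r (\<lambda>t. laplace ?f t - g t) \<le> \<rho>"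
      using net[OF f'] unfolding p'_def by blast
    have gs: "g \<in> lorentz_space p' r" using F(2) g(1) unfolding p'_def by blast
    then have gm: "g \<in> borel_measurable (lebesgue_on {0<..})" by (simp add: lorentz_space_def)
    \<comment> \<open>Undoing the dilation on the image side: the error for the dilate of
      \<open>f\<close> is the dilate of \<open>?h - g'\<close>, so both have the same Lorentz
      integral.\<close>
    define g' where "g' = dil p' (1 / c) g"
    have gm': "g' \<in> borel_measurable (lebesgue_on {0<..})" unfolding g'_def using c by (intro dil_measurable gm) simp
    have Lf': "laplace ?f = dil p' c ?h" unfolding p'_def using c assms by (intro laplace_dil fm) auto
    have "laplace ?f \<in> lorentz_space p' r"
      using laplace_measurable[of ?f] C[OF f'] f'(1) by (auto simp: lorentz_space_def intro: le_less_trans)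
    from lorentz_integral_diff_finite[OF pos(4,3) this gs]
    have int: "lorentz_integral p' r (\<lambda>t. laplace ?f t - g t) \<le> ennreal (\<rho> powr r)"
      using g(2) by (intro lorentz_integral_le pos)
    have "g = dil p' c g'" unfolding g'_def using c by (simp add: dil_dil)
    then have "(\<lambda>t. laplace ?f t - g t) = dil p' c (\<lambda>t. ?h t - g' t)"
      unfolding Lf' by (auto simp: dil_def fun_eq_iff right_diff_distrib)
    then have "lorentz_integral p' r (\<lambda>t. laplace ?f t - g t) = lorentz_integral p' r (\<lambda>t. ?h t - g' t)"
      using lorentz_integral_dil[OF pos(4,3) c] by simp
    then have int': "lint p' r (rearr (\<lambda>t. ?h t - g' t)) \<le> ennreal (\<rho> powr r)"
      using int by (simp only: lorentz_integral_eq[OF pos(4,3)])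
    have g'\<delta>: "rearr g' \<delta> \<le> ennreal \<delta>"
      unfolding g'_def using k[OF g(1)] c \<delta> by (simp add: rearr_dil c_def powr_divide powr_minus_divide)
    \<comment> \<open>Write \<open>?h\<close> as \<open>(?h - g') + g'\<close> and spend the shift
      \<delta> of the argument on \<open>g'\<close>, whose rearrangement there is at most
      \<delta>.\<close>
    have "lint p' r (\<lambda>t. rearr ?h (t + \<delta>) - ennreal \<delta>) \<le> lint p' r (rearr (\<lambda>t. ?h t - g' t))"
    proof (rule lint_mono[OF pos(3)])
      fix t :: real assume "0 < t"
      have "rearr (\<lambda>x. (?h x - g' x) + g' x) (t + \<delta>) \<le> rearr (\<lambda>t. ?h t - g' t) t + rearr g' \<delta>"
        using \<open>0 < t\<close> \<delta> by (intro rearr_add borel_measurable_diff hm gm') auto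
      also have "\<dots> \<le> rearr (\<lambda>t. ?h t - g' t) t + ennreal \<delta>"
        by (intro add_left_mono g'\<delta>)
      finally show "rearr ?h (t + \<delta>) - ennreal \<delta> \<le> rearr (\<lambda>t. ?h t - g' t) t"
        by (simp add: ennreal_minus_le_iff add.commute)
    qed
    also note int'
    finally show "lint p' r (\<lambda>t. rearr ?h (t + 1 / real (Suc n)) - ennreal (1 / real (Suc n))) \<le> ennreal (\<rho> powr r)"
      unfolding \<delta>_def .
  qed
  then have "enn2real (lorentz_integral p' r ?h) \<le> \<rho> powr r"
    by (simp add: lorentz_integral_eq pos enn2real_leI)
  then have "lorentz_norm p' r ?h \<le> (\<rho> powr r) powr (1 / r)"
    unfolding lorentz_norm_def using pos by (intro powr_mono2) auto
  also have "\<dots> = \<rho>" using pos \<open>0 < \<rho>\<close> by (simp add: powr_powr)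
  finally show ?thesis unfolding p'_def .
qed

theorem theorem1:
  fixes p q r :: real
  assumes "1 < p" and "1 < q" and "q \<le> r"
  shows "laplace_alpha p q (p / (p - 1)) r = laplace_norm p q (p / (p - 1)) r"
proof -
  define p' where "p' = p / (p - 1)"
  have pos: "0 < p" "0 < q" "0 < r" "0 < p'" using assms by (auto simp: p'_def)
  let ?S = "{lorentz_norm p' r (laplace f) | f. f \<in> lorentz_space p q \<and> lorentz_norm p q f \<le> 1}"
  let ?R = "{\<rho>. \<rho> > 0 \<and> (\<exists>F. finite F \<and> F \<subseteq> lorentz_space p' r \<and>
        (\<forall>f. f \<in> lorentz_space p q \<and> lorentz_norm p q f \<le> 1 \<longrightarrow>
           (\<exists>g\<in>F. lorentz_norm p' r (\<lambda>t. laplace f t - g t) \<le> \<rho>)))}"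
  obtain C where C: "\<And>f. f \<in> lorentz_space p q \<Longrightarrow> lorentz_norm p q f \<le> 1 \<Longrightarrow>
    lorentz_integral p' r (laplace f) \<le> ennreal C"
    using laplace_bounded[OF assms] unfolding p'_def by metis
  \<comment> \<open>The real \<open>Sup\<close> is meaningful only for a nonempty set bounded above;
    this is where boundedness of the transform enters.\<close>
  have bdd: "bdd_above ?S"
  proof (rule bdd_aboveI)
    fix x assume "x \<in> ?S"
    then obtain f where f: "x = lorentz_norm p' r (laplace f)" "f \<in> lorentz_space p q" "lorentz_norm p q f \<le> 1" by blast
    have "enn2real (lorentz_integral p' r (laplace f)) \<le> max 0 C"
      by (intro enn2real_leI) (auto intro!: order_trans[OF C[OF f(2,3)]] ennreal_leI)
    then show "x \<le> max 0 C powr (1 / r)"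
      unfolding f(1) lorentz_norm_def using pos by (intro powr_mono2) auto
  qed
  have zero: "lorentz_norm p' r (laplace (\<lambda>x. 0)) \<in> ?S"
    using lorentz_space_zero[OF pos(1,2)] by auto
  have "0 \<le> lorentz_norm p' r (laplace (\<lambda>x. 0))" by (simp add: lorentz_norm_def)
  also have "\<dots> \<le> Sup ?S" by (rule cSup_upper[OF zero bdd])
  finally have "0 \<le> Sup ?S" .
  \<comment> \<open>The zero function alone is a net for every radius above the operator norm. The
    strict inequality also makes the radius positive.\<close>
  have R: "\<rho> \<in> ?R" if "Sup ?S < \<rho>" for \<rho>
  proof -
    have "lorentz_norm p' r (laplace f) \<le> \<rho>" if "f \<in> lorentz_space p q" "lorentz_norm p q f \<le> 1" for f
      using cSup_upper[OF _ bdd, of "lorentz_norm p' r (laplace f)"] that \<open>Sup ?S < \<rho>\<close> by fastforce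
    then show ?thesis
      using \<open>0 \<le> Sup ?S\<close> that lorentz_space_zero[OF pos(4,3)]
      by (auto intro!: exI[of _ "{\<lambda>x. 0}"])
  qed
  have "Inf ?R \<le> Sup ?S"
  proof (rule field_le_epsilon)
    fix e :: real assume "0 < e"
    have "bdd_below ?R" by (rule bdd_belowI[of _ 0]) auto
    then show "Inf ?R \<le> Sup ?S + e" using R[of "Sup ?S + e"] \<open>0 < e\<close> by (intro cInf_lower) auto
  qed
  \<comment> \<open>Every admissible radius bounds the norm of each single image, by
    \<open>lorentz_norm_laplace_le_net\<close>.\<close>
  moreover have "Sup ?S \<le> Inf ?R"
  proof (rule cInf_greatest)
    have "Sup ?S + 1 \<in> ?R" by (rule R) simp
    then show "?R \<noteq> {}" by (metis (no_types) empty_iff)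
    fix \<rho> assume "\<rho> \<in> ?R"
    from CollectD[OF this] obtain F where F: "0 < \<rho>" "finite F" "F \<subseteq> lorentz_space p' r"
      "\<forall>f. f \<in> lorentz_space p q \<and> lorentz_norm p q f \<le> 1 \<longrightarrow>
           (\<exists>g\<in>F. lorentz_norm p' r (\<lambda>t. laplace f t - g t) \<le> \<rho>)"
      by (elim conjE exE)
    show "Sup ?S \<le> \<rho>"
    proof (rule cSup_least)
      show "?S \<noteq> {}" using zero by (metis (no_types) empty_iff)
      fix x assume "x \<in> ?S"
      then obtain f where f: "x = lorentz_norm p' r (laplace f)" "f \<in> lorentz_space p q" "lorentz_norm p q f \<le> 1" by blast
      show "x \<le> \<rho>"
        unfolding f(1) p'_def
        by (rule lorentz_norm_laplace_le_net[OF assms f(2,3) F(2) _ F(1)])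
          (use F(3,4) in \<open>simp_all add: p'_def\<close>)
    qed
  qed
  ultimately show ?thesis unfolding laplace_alpha_def laplace_norm_def p'_def by (rule antisym)
qed

end
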